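(* Let $D$ be a planar oriented graph of digirth $g\ge 4$ having $n$ vertices and $m$ arcs. Suppose that $D$ is strongly connected. Then $$\mathrm{fv}(D)\le \frac{n-2}{g-3}-\frac{m}{g(g-3)}.$$
   Context: Digraphs are finite, with no loops and no parallel arcs. The digirth of a digraph is the length of a shortest directed cycle. An oriented graph is a digraph of digirth at least $3$ (no pair of opposite arcs). $\mathrm{fv}(D)$ is the minimum size of a feedback vertex set of $D$, i.e. of a set $S\subseteq V(D)$ such that $D-S$ contains no directed cycle. *)

theory Defs
  imports "HOL-Analysis.Analysis" "HOL-Library.Extended_Nat" "Graph_Theory.Graph_Theory"
begin

text \<open>The infimum is \<open>\<infinity>\<close> for acyclic digraphs, so \<open>digirth D = enat g\<close> entails that
  \<open>D\<close> has a directed cycle.\<close>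
definition digirth :: "('a, 'b) pre_digraph \<Rightarrow> enat" where
  "digirth D = (INF p \<in> {p. pre_digraph.cycle D p}. enat (length p))"

definition oriented_graph :: "('a, 'b) pre_digraph \<Rightarrow> bool" where
  "oriented_graph D \<longleftrightarrow> digraph D \<and> 3 \<le> digirth D"

text \<open>A drawing places the vertices at distinct points of the plane and renders every arc \<open>a\<close> as a
  simple curve \<open>\<gamma> a\<close> joining its end points, such that the curve contains no further vertex and
  two different curves meet only in common end vertices. Curves are injective on the closed unit
  interval, so the notion is meant for loopless digraphs; the orientation of \<open>\<gamma> a\<close> is
  immaterial. Parallel or opposite arcs are admitted.\<close>
definition plane_drawing ::
  "('a, 'b) pre_digraph \<Rightarrow> ('a \<Rightarrow> complex) \<Rightarrow> ('b \<Rightarrow> real \<Rightarrow> complex) \<Rightarrow> bool" where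
  "plane_drawing D pos \<gamma> \<longleftrightarrow>
     inj_on pos (verts D) \<and>
     (\<forall>a \<in> arcs D. arc (\<gamma> a) \<and>
        pathstart (\<gamma> a) = pos (tail D a) \<and> pathfinish (\<gamma> a) = pos (head D a)) \<and>
     (\<forall>a \<in> arcs D. \<forall>v \<in> verts D.
        pos v \<in> path_image (\<gamma> a) \<longrightarrow> v = tail D a \<or> v = head D a) \<and>
     (\<forall>a \<in> arcs D. \<forall>b \<in> arcs D. a \<noteq> b \<longrightarrow>
        path_image (\<gamma> a) \<inter> path_image (\<gamma> b)
          \<subseteq> pos ` ({tail D a, head D a} \<inter> {tail D b, head D b}))"

definition planar_digraph :: "('a, 'b) pre_digraph \<Rightarrow> bool" where
  "planar_digraph D \<longleftrightarrow> (\<exists>pos \<gamma>. plane_drawing D pos \<gamma>)"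

definition feedback_vertex_set :: "('a, 'b) pre_digraph \<Rightarrow> 'a set \<Rightarrow> bool" where
  "feedback_vertex_set D S \<longleftrightarrow>
     S \<subseteq> verts D \<and> \<not> (\<exists>p. pre_digraph.cycle (D \<restriction> (verts D - S)) p)"

definition fv :: "('a, 'b) pre_digraph \<Rightarrow> nat" where
  "fv D = Min (card ` {S. feedback_vertex_set D S})"

end

theory Submission
  imports Defs "HOL-Complex_Analysis.Winding_Numbers"
begin

text \<open>
  The proof lives in the plane dual. Draw \<open>D\<close> and give every arc \<open>a\<close> a dual arc from its left face
  \<open>L a\<close> to its right face \<open>R a\<close>. Along a directed cycle the winding number drops by one from the
  left to the right of each of its arcs and changes nowhere else, so a superlevel set of it is a
  set of faces that no dual arc enters: directed cycles of \<open>D\<close> become directed cuts of the dual.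
  Conversely the arcs of a directed cut form a circulation and contain a directed cycle.

  To hit the cuts with vertices instead of arcs, the dual arcs of the arcs into a vertex \<open>v\<close> are
  merged: as long as one of them ends in a face where another one starts, the two are replaced by
  a single dual arc. A directed cut is crossed by one of the resulting shortcuts of \<open>v\<close> if and only
  if it is crossed by an arc into \<open>v\<close> (\<open>shortcut_multiset\<close>). So the vertices that own a set of
  shortcuts meeting all directed cuts form a feedback vertex set. Since a directed cut contains a
  cycle with at least \<open>g\<close> vertices, it is crossed by at least \<open>g\<close> shortcuts, and if there are \<open>b\<close>
  shortcuts in all, then at most \<open>b / g\<close> directed cuts can be pairwise disjoint. The
  Lucchesi--Younger theorem (\<open>lucchesi_younger\<close>) turns this packing bound into a covering bound:
  \<open>g fv(D) \<le> b\<close>.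

  The number \<open>b\<close> is counted face by face (\<open>face_inequality\<close>). For a face \<open>\<phi>\<close> let \<open>l\<close> be the number of
  arcs on it and \<open>t\<close> the number of shortcuts starting or ending in it, so that these \<open>t\<close> add up to
  \<open>2 b\<close>. Two arcs into the same vertex with \<open>\<phi>\<close> on opposite sides cancel, hence \<open>l - t\<close> is even and
  nonnegative; if it vanishes, then nothing cancels and the boundary of \<open>\<phi>\<close> contains a directed cycle,
  so \<open>l \<ge> g\<close>; and \<open>l \<ge> 3\<close> in any case. Either way \<open>(g - 3) t \<le> (g - 1) l - 2 g\<close>. As the \<open>l\<close> add up
  to \<open>2 m\<close> and there are at least \<open>m - n + 2\<close> faces, summation gives
  \<open>(g - 3) b \<le> g (n - 2) - m\<close>, which is the claim.

  What is needed from the drawing, whose curves are arbitrary arcs, is collected in the locale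
  \<open>facial_digraph\<close>. By strong connectivity each arc \<open>e\<close> lies on a simple closed curve, and the Jordan
  curve theorem provides points \<open>l e\<close> and \<open>r e\<close> near the midpoint of \<open>e\<close> between which its winding
  number drops by one. The arcs are then drawn one at a time. By Janiszewski's theorem an arc between two
  components of the part already drawn separates nothing, and an arc between linked vertices splits
  one face into the face of \<open>l e\<close> and that of \<open>r e\<close>. Induction on the set of drawn arcs
  yields Euler's inequality, the connectedness of the dual, and the fact that the boundary of every
  face is a circulation.
\<close>

section \<open>The Lucchesi--Younger theorem for crossing families\<close>

lemma card_square_mono: "finite N \<Longrightarrow> X \<subseteq> N \<Longrightarrow> card X ^ 2 \<le> card N ^ 2"
  by (simp add: card_mono power_mono)

text \<open>
  The members of \<open>F\<close> play the role of directed cuts: no arc of \<open>B\<close> enters one of them. Closure under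
  intersection and union is required of crossing pairs only, since the empty set and \<open>N\<close> are not cuts.
\<close>
locale crossing_family =
  fixes N :: "'n set" and F :: "'n set set" and B :: "'e set" and src dst :: "'e \<Rightarrow> 'n"
  assumes finite_N: "finite N" and finite_B: "finite B"
    and F_sub: "X \<in> F \<Longrightarrow> X \<subseteq> N"
    and F_crossing: "\<lbrakk>X \<in> F; Y \<in> F; X \<inter> Y \<noteq> {}; X \<union> Y \<noteq> N\<rbrakk> \<Longrightarrow> X \<inter> Y \<in> F \<and> X \<union> Y \<in> F"
    and src_N: "b \<in> B \<Longrightarrow> src b \<in> N" and dst_N: "b \<in> B \<Longrightarrow> dst b \<in> N"
    and no_enter: "\<lbrakk>X \<in> F; b \<in> B; dst b \<in> X\<rbrakk> \<Longrightarrow> src b \<in> X"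
begin

definition leaves :: "'e \<Rightarrow> 'n set \<Rightarrow> bool" where
  "leaves b X \<longleftrightarrow> src b \<in> X \<and> dst b \<notin> X"

text \<open>
  The members of a packing are indexed, because a set may occur several times as soon as a capacity exceeds one.
\<close>
definition packing :: "('e \<Rightarrow> nat) \<Rightarrow> nat \<Rightarrow> (nat \<Rightarrow> 'n set) \<Rightarrow> bool" where
  "packing c k X \<longleftrightarrow> (\<forall>i<k. X i \<in> F) \<and> (\<forall>b\<in>B. card {i. i < k \<and> leaves b (X i)} \<le> c b)"

definition feasible :: "('e \<Rightarrow> nat) \<Rightarrow> nat \<Rightarrow> bool" where
  "feasible c k \<longleftrightarrow> (\<exists>X. packing c k X)"

text \<open>
  As no arc enters \<open>X i\<close> or \<open>X j\<close>, none runs between \<open>X i - X j\<close> and \<open>X j - X i\<close>; these are the only arcs that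
  uncrossing could affect.
\<close>
lemma uncross_count:
  fixes X :: "nat \<Rightarrow> 'n set"
  assumes XF: "\<And>i. i < k \<Longrightarrow> X i \<in> F" and ij: "i < k" "j < k" "i \<noteq> j" and b: "b \<in> B"
  defines "X' \<equiv> X(i := X i \<inter> X j, j := X i \<union> X j)"
  shows "card {l. l < k \<and> leaves b (X' l)} = card {l. l < k \<and> leaves b (X l)}"
proof -
  have split: "card {l. l < k \<and> P l} = (\<Sum>l\<in>{..<k}-{i,j}. of_bool (P l)) + (of_bool (P i) + of_bool (P j))"
    for P :: "nat \<Rightarrow> bool"
  proof -
    have "card {l. l < k \<and> P l} = (\<Sum>l<k. of_bool (P l))"
      by (simp add: sum_of_bool_eq lessThan_def Collect_conj_eq)
    also have "\<dots> = (\<Sum>l\<in>{..<k}-{i,j}. of_bool (P l)) + (\<Sum>l\<in>{i,j}. of_bool (P l))"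
      using ij by (intro sum.subset_diff) auto
    finally show ?thesis using ij by simp
  qed
  have "(\<Sum>l\<in>{..<k}-{i,j}. of_bool (leaves b (X' l))) = (\<Sum>l\<in>{..<k}-{i,j}. of_bool (leaves b (X l)) :: nat)"
    by (intro sum.cong) (auto simp: X'_def)
  moreover have "of_bool (leaves b (X' i)) + of_bool (leaves b (X' j))
      = (of_bool (leaves b (X i)) + of_bool (leaves b (X j)) :: nat)"
    using ij no_enter[OF XF[OF ij(1)] b] no_enter[OF XF[OF ij(2)] b]
    by (auto simp: X'_def leaves_def)
  ultimately show ?thesis
    unfolding split[of "\<lambda>l. leaves b (X' l)"] split[of "\<lambda>l. leaves b (X l)"] by simp
qed

definition cross_free :: "nat \<Rightarrow> (nat \<Rightarrow> 'n set) \<Rightarrow> bool" where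
  "cross_free k X \<longleftrightarrow> (\<forall>i<k. \<forall>j<k. X i \<subseteq> X j \<or> X j \<subseteq> X i \<or> X i \<inter> X j = {} \<or> X i \<union> X j = N)"

text \<open>
  Uncrossing a pair increases the sum of the squared cardinalities, so a packing maximising this sum has
  no crossing pair left.
\<close>
lemma cross_free_packing:
  assumes "feasible c k"
  obtains X where "packing c k X" "cross_free k X"
proof -
  define w where "w X = (\<Sum>i<k. card (X i) ^ 2)" for X :: "nat \<Rightarrow> 'n set"
  have bound: "w X \<le> k * card N ^ 2" if "packing c k X" for X
  proof -
    have "w X \<le> (\<Sum>i<k. card N ^ 2)"
      unfolding w_def using that F_sub finite_N
      by (intro sum_mono card_square_mono) (auto simp: packing_def)
    then show ?thesis by simp
  qed
  obtain X0 where "packing c k X0" using assms by (auto simp: feasible_def)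
  then have "\<exists>X. packing c k X \<and> (\<forall>Y. packing c k Y \<longrightarrow> w Y \<le> w X)"
    using bound by (intro ex_has_greatest_nat[where b = "Suc (k * card N ^ 2)"]) (auto simp: less_Suc_eq_le)
  then obtain X where X: "packing c k X" and max: "\<And>Y. packing c k Y \<Longrightarrow> w Y \<le> w X"
    by auto
  have XF: "X i \<in> F" if "i < k" for i using X that by (auto simp: packing_def)
  have "cross_free k X"
    unfolding cross_free_def
  proof (intro allI impI, rule ccontr)
    fix i j assume ij: "i < k" "j < k"
      and "\<not> (X i \<subseteq> X j \<or> X j \<subseteq> X i \<or> X i \<inter> X j = {} \<or> X i \<union> X j = N)"
    then have cr: "\<not> X i \<subseteq> X j" "\<not> X j \<subseteq> X i" "X i \<inter> X j \<noteq> {}" "X i \<union> X j \<noteq> N" by auto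
    then have "i \<noteq> j" by auto
    define X' where "X' = X(i := X i \<inter> X j, j := X i \<union> X j)"
    have "card {l. l < k \<and> leaves b (X' l)} \<le> c b" if "b \<in> B" for b
      using uncross_count[of k X i j b, OF XF ij \<open>i \<noteq> j\<close> that] X that by (simp add: packing_def X'_def)
    moreover have "X' l \<in> F" if "l < k" for l
      using XF[OF that] F_crossing[OF XF[OF ij(1)] XF[OF ij(2)] cr(3,4)] by (auto simp: X'_def)
    ultimately have "packing c k X'"
      by (simp add: packing_def)
    moreover have "w X < w X'"
    proof -
      have fin: "finite (X i)" "finite (X j)"
        using finite_subset[OF F_sub[OF XF] finite_N] ij by simp_all
      define a where "a = card (X i \<inter> X j)"
      define p where "p = card (X i - X j)"
      define q where "q = card (X j - X i)"
      have pq: "p > 0" "q > 0" using cr fin by (auto simp: p_def q_def card_gt_0_iff)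
      have ci: "card (X i) = a + p" "card (X j) = a + q" "card (X i \<union> X j) = a + p + q"
      proof -
        show 1: "card (X i) = a + p"
          unfolding a_def p_def using fin by (metis card_Int_Diff)
        show 2: "card (X j) = a + q"
          unfolding a_def q_def using fin by (metis card_Int_Diff Int_commute)
        show "card (X i \<union> X j) = a + p + q"
          using card_Un_Int[OF fin] 1 2 unfolding a_def by linarith
      qed
      have split: "w Z = (\<Sum>l\<in>{..<k}-{i,j}. card (Z l) ^ 2) + card (Z i) ^ 2 + card (Z j) ^ 2" for Z
        unfolding w_def using ij \<open>i \<noteq> j\<close>
        by (subst sum.subset_diff[of "{i,j}"]) auto
      have "w X' = (\<Sum>l\<in>{..<k}-{i,j}. card (X l) ^ 2) + a ^ 2 + (a + p + q) ^ 2"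
        unfolding split[of X'] using \<open>i \<noteq> j\<close> ci by (simp add: X'_def a_def)
      moreover have "w X = (\<Sum>l\<in>{..<k}-{i,j}. card (X l) ^ 2) + (a + p) ^ 2 + (a + q) ^ 2"
        unfolding split[of X] ci by simp
      moreover have "(a + p) ^ 2 + (a + q) ^ 2 < a ^ 2 + (a + p + q) ^ 2"
        using pq by (simp add: power2_eq_square algebra_simps)
      ultimately show ?thesis by linarith
    qed
    ultimately show False using max[of X'] by linarith
  qed
  then show thesis using that X by blast
qed

lemma card_parity_interval:
  fixes q c :: nat
  shows "card {x. q \<le> x \<and> x < q + 2 * c \<and> (even x \<longleftrightarrow> e)} \<le> c"
proof -
  have "{x. q \<le> x \<and> x < q + 2 * c \<and> (even x \<longleftrightarrow> e)} \<subseteq> (\<lambda>i. q + 2 * i + of_bool (even q \<noteq> e)) ` {..<c}"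
  proof
    fix x assume "x \<in> {x. q \<le> x \<and> x < q + 2 * c \<and> (even x \<longleftrightarrow> e)}"
    then have x: "q \<le> x" "x < q + 2 * c" "even x \<longleftrightarrow> e" by auto
    then have "(x - q) mod 2 = of_bool (even q \<noteq> e)"
      by (auto simp: mod2_eq_if)
    then have "x = q + 2 * ((x - q) div 2) + of_bool (even q \<noteq> e)"
      using x div_mult_mod_eq[of "x - q" 2] by linarith
    moreover have "(x - q) div 2 < c" using x by auto
    ultimately show "x \<in> (\<lambda>i. q + 2 * i + of_bool (even q \<noteq> e)) ` {..<c}" by blast
  qed
  then have "card {x. q \<le> x \<and> x < q + 2 * c \<and> (even x \<longleftrightarrow> e)} \<le> card ((\<lambda>i. q + 2 * i + of_bool (even q \<noteq> e)) ` {..<c})"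
    by (intro card_mono) auto
  also have "\<dots> \<le> c" by (metis card_image_le card_lessThan finite_lessThan)
  finally show ?thesis .
qed

text \<open>
  A cross-free family is represented by a tree whose edges are its members, and every arc of \<open>B\<close> traverses
  a directed path of this tree. The depth of \<open>X i\<close> is the number of members that do not have the tail of the
  tree edge of \<open>X i\<close> on their near side; it rises by one from an edge to the next one on a directed path. The
  comparison \<open>j < i\<close> puts repeated members in series.
\<close>
definition depth :: "nat \<Rightarrow> (nat \<Rightarrow> 'n set) \<Rightarrow> nat \<Rightarrow> nat" where
  "depth k X i = card {j. j < k \<and> X i \<union> X j \<noteq> N \<and> (\<not> X i \<subseteq> X j \<or> X i = X j \<and> j < i)}"

text \<open>
  The members crossed by \<open>b\<close> form a chain and, by their depths, occupy distinct places in an interval of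
  length at most \<open>2 * c b\<close>. Half of this interval has a given parity.
\<close>
lemma packing_parity:
  assumes X: "packing (\<lambda>b. 2 * c b) k X" and cf: "cross_free k X" and b: "b \<in> B"
  shows "card {i. i < k \<and> leaves b (X i) \<and> (even (depth k X i) \<longleftrightarrow> e)} \<le> c b"
proof -
  define I where "I = {i. i < k \<and> leaves b (X i)}"
  (* By cross-freeness exactly the members in Q and those below X i in the chain count for its depth. *)
  define Q where "Q = {j. j < k \<and> src b \<notin> X j \<and> dst b \<notin> X j}"
  define low where "low i = {j \<in> I. X j \<subset> X i \<or> X i = X j \<and> j < i}" for i
  have finI: "finite I" "finite Q" by (auto simp: I_def Q_def)
  have chain: "X i \<subseteq> X j \<or> X j \<subseteq> X i" if "i \<in> I" "j \<in> I" for i j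
    using cf[unfolded cross_free_def, rule_format, of i j] that dst_N[OF b]
    by (auto simp: I_def leaves_def)
  have depth: "depth k X i = card Q + card (low i)" if i: "i \<in> I" for i
  proof -
    have ik: "i < k" and s: "src b \<in> X i" and d: "dst b \<notin> X i" using i by (auto simp: I_def leaves_def)
    have "{j. j < k \<and> X i \<union> X j \<noteq> N \<and> (\<not> X i \<subseteq> X j \<or> X i = X j \<and> j < i)} = Q \<union> low i"
    proof (intro equalityI subsetI)
      fix j assume "j \<in> {j. j < k \<and> X i \<union> X j \<noteq> N \<and> (\<not> X i \<subseteq> X j \<or> X i = X j \<and> j < i)}"
      then have j: "j < k" "X i \<union> X j \<noteq> N" "\<not> X i \<subseteq> X j \<or> X i = X j \<and> j < i" by auto
      have en: "dst b \<in> X j \<Longrightarrow> src b \<in> X j" using X j no_enter b by (auto simp: packing_def)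
      have "dst b \<notin> X j"
        using cf[unfolded cross_free_def, rule_format, OF ik \<open>j < k\<close>] j en s d by blast
      show "j \<in> Q \<union> low i"
      proof (cases "src b \<in> X j")
        case True
        then have "j \<in> I" using \<open>dst b \<notin> X j\<close> j by (auto simp: I_def leaves_def)
        then show ?thesis using chain[OF i] j unfolding low_def by blast
      qed (use \<open>dst b \<notin> X j\<close> j in \<open>auto simp: Q_def\<close>)
    next
      fix j assume "j \<in> Q \<union> low i"
      then show "j \<in> {j. j < k \<and> X i \<union> X j \<noteq> N \<and> (\<not> X i \<subseteq> X j \<or> X i = X j \<and> j < i)}"
        using s d dst_N[OF b] by (auto simp: Q_def low_def I_def leaves_def)
    qed
    moreover have "card (Q \<union> low i) = card Q + card (low i)"
      using finI by (intro card_Un_disjoint) (auto simp: Q_def low_def I_def leaves_def)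
    ultimately show ?thesis unfolding depth_def by simp
  qed
  have mono: "card (low i) < card (low j)" if "i \<in> low j" "j \<in> I" for i j
  proof (rule psubset_card_mono)
    show "finite (low j)" using finI by (auto simp: low_def)
    have "low i \<subseteq> low j" using that by (auto simp: low_def)
    moreover have "i \<notin> low i" by (auto simp: low_def)
    ultimately show "low i \<subset> low j" using that by blast
  qed
  have inj: "inj_on (depth k X) I"
  proof (rule inj_onI, rule ccontr)
    fix i j assume ij: "i \<in> I" "j \<in> I" "depth k X i = depth k X j" "i \<noteq> j"
    then have "i \<in> low j \<or> j \<in> low i"
      using chain[OF ij(1,2)] by (auto simp: low_def)
    then show False using mono[of i j] mono[of j i] depth ij by auto
  qed
  have lowlt: "card (low i) < card I" if "i \<in> I" for i
    using that finI by (intro psubset_card_mono) (auto simp: low_def)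
  have cI: "card I \<le> 2 * c b" using X b by (auto simp: packing_def I_def)
  have "card {i \<in> I. even (depth k X i) \<longleftrightarrow> e} = card (depth k X ` {i \<in> I. even (depth k X i) \<longleftrightarrow> e})"
    using inj by (intro card_image[symmetric]) (auto intro: inj_on_subset)
  also have "\<dots> \<le> card {x. card Q \<le> x \<and> x < card Q + 2 * c b \<and> (even x \<longleftrightarrow> e)}"
    using depth lowlt cI by (intro card_mono) force+
  also have "\<dots> \<le> c b" by (rule card_parity_interval)
  finally show ?thesis by (simp add: I_def conj_assoc)
qed

lemma packing_of_index_set:
  fixes X :: "nat \<Rightarrow> 'n set"
  assumes I: "I \<subseteq> {..<k}" "card I = l" and X: "\<And>i. i < k \<Longrightarrow> X i \<in> F"
    and c: "\<And>b. b \<in> B \<Longrightarrow> card {i \<in> I. leaves b (X i)} \<le> c b"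
  shows "feasible c l"
proof -
  have fin: "finite I" using finite_subset[OF I(1)] by simp
  obtain h where "bij_betw h {0..<card I} I"
    using ex_bij_betw_nat_finite[OF fin] by blast
  then have h: "bij_betw h {..<l} I" using I(2) by (simp add: atLeast0LessThan)
  have hI: "h i \<in> I" if "i < l" for i using h that by (auto simp: bij_betw_def)
  have inj: "inj_on h {..<l}" using h by (simp add: bij_betw_def)
  have "packing c l (X \<circ> h)"
    unfolding packing_def
  proof (intro conjI ballI allI impI)
    fix i assume "i < l" then have "h i \<in> I" by (rule hI)
    then show "(X \<circ> h) i \<in> F" using X I by auto
  next
    fix b assume b: "b \<in> B"
    have "card {i. i < l \<and> leaves b ((X \<circ> h) i)} = card (h ` {i. i < l \<and> leaves b ((X \<circ> h) i)})"
      by (intro card_image[symmetric] inj_on_subset[OF inj]) auto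
    also have "\<dots> \<le> card {i \<in> I. leaves b (X i)}"
      using hI fin by (intro card_mono) auto
    finally show "card {i. i < l \<and> leaves b ((X \<circ> h) i)} \<le> c b" using c[OF b] by linarith
  qed
  then show ?thesis by (auto simp: feasible_def)
qed

lemma feasible_mono:
  assumes "feasible c k" "l \<le> k"
  shows "feasible c l"
proof -
  obtain X where X: "packing c k X" using assms by (auto simp: feasible_def)
  have "card {i \<in> {..<l}. leaves b (X i)} \<le> c b" if "b \<in> B" for b
  proof -
    have "card {i \<in> {..<l}. leaves b (X i)} \<le> card {i. i < k \<and> leaves b (X i)}"
      using assms by (intro card_mono) auto
    then show ?thesis using X that by (auto simp: packing_def intro: le_trans)
  qed
  then show ?thesis using X assms
    by (intro packing_of_index_set[of "{..<l}" k l X]) (auto simp: packing_def)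
qed

text \<open>
  Splitting a cross-free packing by the parity of the depth halves the load of every arc.
\<close>
lemma feasible_half:
  assumes "feasible (\<lambda>b. 2 * c b) (2 * k + 1)"
  shows "feasible c (k + 1)"
proof -
  let ?K = "2 * k + 1"
  obtain X where X: "packing (\<lambda>b. 2 * c b) ?K X" "cross_free ?K X"
    using cross_free_packing[OF assms] by blast
  define I where "I e = {i. i < ?K \<and> (even (depth ?K X i) \<longleftrightarrow> e)}" for e
  have "I True \<union> I False = {..<?K}" "I True \<inter> I False = {}" by (auto simp: I_def)
  then have "card (I True) + card (I False) = ?K"
    by (metis card_Un_disjoint card_lessThan finite_Un finite_lessThan)
  then obtain e where e: "k + 1 \<le> card (I e)"
    by (cases "k + 1 \<le> card (I True)") (auto intro: that[of True] that[of False])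
  have "feasible c (card (I e))"
  proof (rule packing_of_index_set[of "I e" ?K _ X])
    fix b assume "b \<in> B"
    have "{i \<in> I e. leaves b (X i)} = {i. i < ?K \<and> leaves b (X i) \<and> (even (depth ?K X i) \<longleftrightarrow> e)}"
      by (auto simp: I_def)
    then show "card {i \<in> I e. leaves b (X i)} \<le> c b"
      using packing_parity[OF X \<open>b \<in> B\<close>, of e] by (simp only:)
  qed (use X in \<open>auto simp: I_def packing_def\<close>)
  then show ?thesis using e by (rule feasible_mono)
qed

lemma feasible_combine:
  assumes "feasible c k" "feasible d l"
  shows "feasible (\<lambda>b. c b + d b) (k + l)"
proof -
  obtain X Y where X: "packing c k X" and Y: "packing d l Y" using assms by (auto simp: feasible_def)
  define Z where "Z i = (if i < k then X i else Y (i - k))" for i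
  have "packing (\<lambda>b. c b + d b) (k + l) Z"
    unfolding packing_def
  proof (intro conjI ballI allI impI)
    fix i assume "i < k + l" then show "Z i \<in> F" using X Y by (auto simp: Z_def packing_def)
  next
    fix b assume b: "b \<in> B"
    have "{i. i < k + l \<and> leaves b (Z i)} = {i. i < k \<and> leaves b (X i)} \<union> (\<lambda>i. i + k) ` {i. i < l \<and> leaves b (Y i)}"
      (is "?A = ?L \<union> ?R")
    proof (intro equalityI subsetI)
      fix i assume i: "i \<in> ?A"
      show "i \<in> ?L \<union> ?R"
      proof (cases "i < k")
        case False
        then have "i - k \<in> {i. i < l \<and> leaves b (Y i)}" "i = i - k + k" using i by (auto simp: Z_def)
        then show ?thesis by blast
      qed (use i in \<open>auto simp: Z_def\<close>)
    qed (auto simp: Z_def)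
    also have "card \<dots> \<le> card ?L + card ?R" by (rule card_Un_le)
    also have "card ?R = card {i. i < l \<and> leaves b (Y i)}" by (intro card_image) auto
    finally show "card ?A \<le> c b + d b" using X Y b by (force simp: packing_def)
  qed
  then show ?thesis by (auto simp: feasible_def)
qed

lemma feasible_cong:
  assumes "feasible c k" "\<And>b. b \<in> B \<Longrightarrow> c b \<le> d b"
  shows "feasible d k"
proof -
  obtain X where "packing c k X" using assms(1) by (auto simp: feasible_def)
  then have "packing d k X" using assms(2) le_trans unfolding packing_def by blast
  then show ?thesis by (auto simp: feasible_def)
qed

text \<open>
  This is the argument of Lovasz. Raise the capacities as long as \<open>k + 1\<close> cuts cannot be packed; capacities
  above \<open>k + 1\<close> have no effect. If an arc \<open>e\<close> of intermediate capacity remains, then \<open>k + 1\<close> cuts can be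
  packed with one more unit on \<open>e\<close>. Were it possible to pack \<open>k\<close> cuts with one unit less on \<open>e\<close>, the two packings
  together would have \<open>2 * k + 1\<close> members and load at most twice the capacity, and halving would
  give \<open>k + 1\<close> cuts within the capacity. So taking a unit from \<open>e\<close> lowers the packing number, and a
  cover for the smaller number costs at most one more here. If no such arc remains, the arcs of capacity zero meet
  every cut, because a cut avoiding them could be taken \<open>k + 1\<close> times.
\<close>
theorem lucchesi_younger:
  assumes "\<not> feasible c (k + 1)"
  shows "\<exists>J\<subseteq>B. sum c J \<le> k \<and> (\<forall>X\<in>F. \<exists>b\<in>J. leaves b X)"
  using assms
proof (induction k arbitrary: c)
  case (0 c)
  have "\<exists>b\<in>{b \<in> B. c b = 0}. leaves b X" if "X \<in> F" for X
  proof (rule ccontr)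
    assume no: "\<not> ?thesis"
    have "card {i. i < (1::nat) \<and> leaves b X} \<le> c b" if "b \<in> B" for b
      using no that by (cases "leaves b X") (auto simp: Suc_le_eq)
    then have "packing c 1 (\<lambda>_. X)"
      using that by (simp add: packing_def)
    then show False using 0 by (auto simp: feasible_def)
  qed
  then show ?case by (intro exI[of _ "{b \<in> B. c b = 0}"]) auto
next
  case (Suc k c)
  let ?K = "Suc k + 1"
  define ok where "ok d \<longleftrightarrow> (\<forall>b\<in>B. c b \<le> d b \<and> d b \<le> max (c b) ?K) \<and> \<not> feasible d ?K" for d
  have "ok c" using Suc.prems by (auto simp: ok_def)
  moreover have "sum d B \<le> (\<Sum>b\<in>B. max (c b) ?K)" if "ok d" for d
    using that by (intro sum_mono) (auto simp: ok_def)
  ultimately have "\<exists>d. ok d \<and> (\<forall>d'. ok d' \<longrightarrow> sum d' B \<le> sum d B)"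
    by (intro ex_has_greatest_nat[where b = "Suc (\<Sum>b\<in>B. max (c b) ?K)"]) (auto simp: less_Suc_eq_le)
  then obtain d where d: "ok d" and max: "\<And>d'. ok d' \<Longrightarrow> sum d' B \<le> sum d B"
    by auto
  have cd: "sum c J \<le> sum d J" if "J \<subseteq> B" for J using that d by (intro sum_mono) (auto simp: ok_def)
  have nf: "\<not> feasible d ?K" using d by (simp add: ok_def)
  show ?case
  proof (cases "\<exists>e\<in>B. 0 < d e \<and> d e < ?K")
    case True
    then obtain e where e: "e \<in> B" "0 < d e" "d e < ?K" by blast
    have up: "feasible (d(e := d e + 1)) ?K"
    proof (rule ccontr)
      assume "\<not> feasible (d(e := d e + 1)) ?K"
      then have "ok (d(e := d e + 1))" using d e by (auto simp: ok_def)
      moreover have "sum d B < sum (d(e := d e + 1)) B"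
        using e finite_B by (intro sum_strict_mono_ex1) auto
      ultimately show False using max by fastforce
    qed
    have "\<not> feasible (d(e := d e - 1)) (k + 1)"
    proof
      assume "feasible (d(e := d e - 1)) (k + 1)"
      from feasible_combine[OF this up]
      have "feasible (\<lambda>b. (d(e := d e - 1)) b + (d(e := d e + 1)) b) (2 * (k + 1) + 1)"
        by (simp only: mult_2 add_Suc_right add_Suc Suc_eq_plus1 add.assoc add.commute add.left_commute)
      then have "feasible (\<lambda>b. 2 * d b) (2 * (k + 1) + 1)"
        by (rule feasible_cong) (use e in \<open>auto simp: eval_nat_numeral\<close>)
      then have "feasible d (k + 1 + 1)" by (rule feasible_half)
      then show False using nf by simp
    qed
    from Suc.IH[OF this] obtain J where J: "J \<subseteq> B" "sum (d(e := d e - 1)) J \<le> k" "\<forall>X\<in>F. \<exists>b\<in>J. leaves b X"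
      by blast
    have "finite J" using finite_subset[OF J(1) finite_B] .
    have "sum d J \<le> (\<Sum>b\<in>J. (d(e := d e - 1)) b + of_bool (b = e))"
      by (intro sum_mono) auto
    also have "\<dots> \<le> k + 1"
      using J \<open>finite J\<close> by (simp add: sum.distrib of_bool_def sum.delta' del: fun_upd_apply)
    finally have "sum c J \<le> Suc k" using cd[OF J(1)] by linarith
    then show ?thesis using J by blast
  next
    case False
    let ?J = "{b \<in> B. d b = 0}"
    have "\<exists>b\<in>?J. leaves b X" if "X \<in> F" for X
    proof (rule ccontr)
      assume no: "\<not> ?thesis"
      have "packing d ?K (\<lambda>_. X)"
        unfolding packing_def
      proof (intro conjI ballI allI impI)
        fix b assume "b \<in> B"
        show "card {i. i < ?K \<and> leaves b X} \<le> d b"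
        proof (cases "leaves b X")
          case True
          then have "?K \<le> d b" using no \<open>b \<in> B\<close> False by (metis (mono_tags, lifting) gr_zeroI leI mem_Collect_eq)
          moreover have "card {i. i < ?K \<and> leaves b X} \<le> card {..<?K}"
            by (intro card_mono) auto
          ultimately show ?thesis by simp
        qed simp
      qed (use that in auto)
      then show False using nf by (auto simp: feasible_def)
    qed
    moreover have "sum c ?J \<le> Suc k" using cd[of ?J] by simp
    ultimately show ?thesis by (intro exI[of _ ?J]) auto
  qed
qed

end

section \<open>Separation of the plane by arcs\<close>

(* From here on, connected refers to topological spaces rather than to graphs. *)
hide_const (open) Digraph_Component.connected

abbreviation joined_off :: "complex set \<Rightarrow> complex \<Rightarrow> complex \<Rightarrow> bool" where
  "joined_off S \<equiv> connected_component (- S)"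

lemma joined_off_antimono: "joined_off T y z \<Longrightarrow> S \<subseteq> T \<Longrightarrow> joined_off S y z"
  by (meson Compl_subset_Compl_iff connected_component_of_subset)

lemma joined_off_notin: "joined_off S y z \<Longrightarrow> y \<notin> S \<and> z \<notin> S"
  by (meson ComplD connected_component_in)

lemma joined_off_connected: "\<lbrakk>connected C; y \<in> C; z \<in> C; C \<inter> S = {}\<rbrakk> \<Longrightarrow> joined_off S y z"
  unfolding connected_component_def by (intro exI[of _ C]) auto

lemma winding_number_joined_off:
  assumes "path c" "pathfinish c = pathstart c" "joined_off S y z" "path_image c \<subseteq> S"
  shows "winding_number c y = winding_number c z"
proof -
  have "y \<in> connected_component_set (- S) y" "z \<in> connected_component_set (- S) y"
    using assms(3) joined_off_notin[OF assms(3)] by auto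
  moreover have "connected_component_set (- S) y \<inter> path_image c = {}"
    using connected_component_subset[of "- S" y] assms(4) by blast
  ultimately show ?thesis
    using winding_number_eq[OF assms(1,2)] connected_connected_component by blast
qed

lemma joined_off_pendant_arc:
  assumes K: "compact K" and \<gamma>: "arc \<gamma>" and K\<gamma>: "K \<inter> path_image \<gamma> \<subseteq> {p}"
    and yz: "joined_off K y z" "y \<notin> path_image \<gamma>" "z \<notin> path_image \<gamma>"
  shows "joined_off (K \<union> path_image \<gamma>) y z"
proof (rule Janiszewski[OF K])
  show "closed (path_image \<gamma>)" using \<gamma> by (simp add: closed_arc_image)
  show "connected (K \<inter> path_image \<gamma>)" using K\<gamma> by (metis connected_empty connected_sing subset_singletonD)
  show "joined_off (path_image \<gamma>) y z"
    using connected_arc_complement[OF \<gamma>] yz by (intro joined_off_connected[of "- path_image \<gamma>"]) auto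
qed (fact yz)

text \<open>
  Janiszewski's theorem is applied twice: the arc meets \<open>K1\<close> in at most one point, and the union of the two
  then meets \<open>K2\<close> in at most one point.
\<close>
lemma joined_off_bridge_arc:
  assumes K: "compact K1" "compact K2" "K1 \<inter> K2 = {}" and \<gamma>: "arc \<gamma>"
    and K\<gamma>: "K1 \<inter> path_image \<gamma> \<subseteq> {p}" "K2 \<inter> path_image \<gamma> \<subseteq> {q}"
    and yz: "joined_off (K1 \<union> K2) y z" "y \<notin> path_image \<gamma>" "z \<notin> path_image \<gamma>"
  shows "joined_off (K1 \<union> K2 \<union> path_image \<gamma>) y z"
proof -
  have "joined_off ((K1 \<union> path_image \<gamma>) \<union> K2) y z"
  proof (rule Janiszewski)
    show "compact (K1 \<union> path_image \<gamma>)" using K \<gamma> by (simp add: compact_Un compact_arc_image)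
    show "closed K2" using K by (simp add: compact_imp_closed)
    have "(K1 \<union> path_image \<gamma>) \<inter> K2 \<subseteq> {q}" using K K\<gamma> by blast
    then show "connected ((K1 \<union> path_image \<gamma>) \<inter> K2)" by (metis connected_empty connected_sing subset_singletonD)
    show "joined_off (K1 \<union> path_image \<gamma>) y z"
      using yz K K\<gamma> \<gamma> by (intro joined_off_pendant_arc[of _ _ p] joined_off_antimono[OF yz(1)]) auto
    show "joined_off K2 y z" using yz(1) by (rule joined_off_antimono) simp
  qed
  then show ?thesis by (simp add: Un_ac)
qed

text \<open>
  What is left of a curve when the part around its midpoint is removed. The remaining two pieces do not
  separate points on their own, and in a small disc around the midpoint they are invisible.
\<close>
definition outer_parts :: "(real \<Rightarrow> complex) \<Rightarrow> real \<Rightarrow> complex set" where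
  "outer_parts \<gamma> e = \<gamma> ` {0..1/2 - e} \<union> \<gamma> ` {1/2 + e..1}"

text \<open>
  A face cut off by a new arc comes arbitrarily close to the midpoint of this arc. A path from \<open>y\<close> to \<open>z\<close> off
  \<open>K\<close> has to cross the arc, and one can walk along the arc to its midpoint; the two end pieces of the arc
  are pendant arcs and do not obstruct. Hence the component of \<open>y\<close> has a frontier point in the
  removed middle piece, which may be chosen as small as desired.
\<close>
lemma chord_face_near_midpoint:
  assumes K: "compact K" and \<gamma>: "arc \<gamma>" and K\<gamma>: "K \<inter> path_image \<gamma> = {\<gamma> 0, \<gamma> 1}"
    and yz: "joined_off K y z" "\<not> joined_off (K \<union> path_image \<gamma>) y z" "y \<notin> path_image \<gamma>"
    and d: "d > 0"
  obtains y' where "joined_off (K \<union> path_image \<gamma>) y y'" "y' \<in> ball (\<gamma> (1/2)) d"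
proof -
  define E where "E = path_image \<gamma>"
  define x where "x = \<gamma> (1/2)"
  have inj: "inj_on \<gamma> {0..1}" and cont: "continuous_on {0..1} \<gamma>"
    using \<gamma> by (auto simp: arc_def path_def)
  have E: "E = \<gamma> ` {0..1}" by (simp add: E_def path_image_def)
  obtain \<epsilon> where \<epsilon>: "\<epsilon> > 0" "\<epsilon> \<le> 1/4" and near: "\<And>t. \<bar>t - 1/2\<bar> < \<epsilon> \<Longrightarrow> \<gamma> t \<in> ball x d"
  proof -
    obtain \<delta> where "\<delta> > 0" and \<delta>: "\<And>t. t \<in> {0..1} \<Longrightarrow> dist t (1/2) < \<delta> \<Longrightarrow> dist (\<gamma> t) (\<gamma> (1/2)) < d"
      using cont[unfolded continuous_on_iff, rule_format, of "1/2" d] d by auto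
    show thesis
    proof (rule that[of "min \<delta> (1/4)"])
      fix t :: real assume "\<bar>t - 1/2\<bar> < min \<delta> (1/4)"
      then show "\<gamma> t \<in> ball x d" using \<delta>[of t] by (auto simp: x_def dist_real_def dist_commute abs_if split: if_splits)
    qed (use \<open>\<delta> > 0\<close> in auto)
  qed
  define E1 where "E1 = path_image (subpath 0 (1/2 - \<epsilon>) \<gamma>)"
  define E2 where "E2 = path_image (subpath (1/2 + \<epsilon>) 1 \<gamma>)"
  have E1: "E1 = \<gamma> ` {0..1/2 - \<epsilon>}" and E2: "E2 = \<gamma> ` {1/2 + \<epsilon>..1}"
    using \<epsilon> by (simp_all add: E1_def E2_def path_image_subpath)
  have arcs: "arc (subpath 0 (1/2 - \<epsilon>) \<gamma>)" "arc (subpath (1/2 + \<epsilon>) 1 \<gamma>)"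
    using \<epsilon> \<gamma> by (auto intro!: arc_subpath_arc)
  have disj: "\<gamma> s \<noteq> \<gamma> t" if "s \<in> {0..1}" "t \<in> {0..1}" "s \<noteq> t" for s t
    using inj that by (auto dest: inj_onD)
  have y: "y \<notin> K" "y \<notin> E" using yz joined_off_notin by (auto simp: E_def)
  have Kt: "\<gamma> t \<notin> K" if "0 < t" "t < 1" for t
    using K\<gamma> disj[of t 0] disj[of t 1] that E by (auto simp: E_def)
  have "joined_off K y x"
  proof -
    define C where "C = connected_component_set (- K) y"
    have C: "connected C" "y \<in> C" "z \<in> C" "C \<inter> K = {}"
      using yz(1) joined_off_notin[OF yz(1)] connected_component_subset[of "-K" y]
      by (auto simp: C_def)
    have "C \<inter> E \<noteq> {}"
    proof
      assume "C \<inter> E = {}"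
      then have "joined_off (K \<union> E) y z" using C by (intro joined_off_connected[of C]) auto
      then show False using yz by (simp add: E_def)
    qed
    then obtain t where t: "t \<in> {0..1}" "\<gamma> t \<in> C" unfolding E by blast
    then have "t \<noteq> 0" "t \<noteq> 1" using C K\<gamma> by auto
    then have "t \<in> {0<..<1}" using t by auto
    have "connected (\<gamma> ` {0<..<1})"
      by (intro connected_continuous_image continuous_on_subset[OF cont]) auto
    then have "joined_off K (\<gamma> t) x"
      using \<open>t \<in> {0<..<1}\<close> Kt by (intro joined_off_connected[of "\<gamma> ` {0<..<1}"]) (auto simp: x_def)
    moreover have "joined_off K y (\<gamma> t)" using t by (simp add: C_def)
    ultimately show ?thesis by (rule connected_component_trans[rotated])
  qed
  moreover have "x \<notin> E1" "x \<notin> E2" using \<epsilon> disj by (auto simp: E1 E2 x_def)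
  moreover have "y \<notin> E1" "y \<notin> E2" using y \<epsilon> by (auto simp: E E1 E2)
  moreover have "K \<inter> E1 \<subseteq> {\<gamma> 0}"
  proof
    fix w assume w: "w \<in> K \<inter> E1"
    then obtain t where t: "w = \<gamma> t" "0 \<le> t" "t \<le> 1/2 - \<epsilon>" by (auto simp: E1)
    then show "w \<in> {\<gamma> 0}" using Kt[of t] w \<epsilon> by (cases "t = 0") auto
  qed
  moreover have "(K \<union> E1) \<inter> E2 \<subseteq> {\<gamma> 1}"
  proof
    fix w assume w: "w \<in> (K \<union> E1) \<inter> E2"
    then obtain t where t: "w = \<gamma> t" "1/2 + \<epsilon> \<le> t" "t \<le> 1" by (auto simp: E2)
    have "w \<notin> E1" using t \<epsilon> disj by (auto simp: E1)
    then have "\<gamma> t \<in> K" using w t by auto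
    then show "w \<in> {\<gamma> 1}" using Kt[of t] t \<epsilon> by (cases "t = 1") auto
  qed
  moreover have "compact (K \<union> E1)" using K arcs by (auto simp: E1_def intro: compact_Un compact_arc_image)
  ultimately have T: "joined_off (K \<union> E1 \<union> E2) y x"
    using joined_off_pendant_arc[OF K arcs(1), of "\<gamma> 0" y x] joined_off_pendant_arc[OF _ arcs(2), of "K \<union> E1" "\<gamma> 1" y x]
    by (simp add: E1_def E2_def)
  define U where "U = connected_component_set (- (K \<union> E)) y"
  have "open (- (K \<union> E))"
    using K \<gamma> by (auto simp: E_def intro!: open_Compl closed_Un compact_imp_closed closed_arc_image)
  then have "open U" by (simp add: U_def open_connected_component)
  have "U \<inter> ball x d \<noteq> {}"
  proof
    assume U: "U \<inter> ball x d = {}"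
    define C where "C = connected_component_set (- (K \<union> E1 \<union> E2)) y"
    have "x \<in> C" "y \<in> C" using T joined_off_notin[OF T] by (auto simp: C_def)
    have "x \<in> ball x d" using d by simp
    then have "x \<notin> U" using U by blast
    moreover have "y \<in> U" using y by (simp add: U_def)
    ultimately have "C \<inter> frontier U \<noteq> {}"
      using \<open>x \<in> C\<close> \<open>y \<in> C\<close> connected_connected_component[of "- (K \<union> E1 \<union> E2)" y]
      by (intro connected_Int_frontier) (fold C_def, blast+)
    then obtain f where f: "f \<in> C" "f \<in> frontier U" by blast
    have "frontier U \<subseteq> frontier (- (K \<union> E))"
      unfolding U_def by (rule frontier_of_connected_component_subset)
    also have "\<dots> \<subseteq> K \<union> E"
      unfolding frontier_complement
      using \<open>open (- (K \<union> E))\<close> by (intro frontier_subset_closed) (simp only: closed_def)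
    finally have "f \<in> K \<union> E" using f by blast
    moreover have "f \<notin> K \<union> E1 \<union> E2"
      using f connected_component_subset[of "- (K \<union> E1 \<union> E2)" y] by (auto simp: C_def)
    ultimately have fE: "f \<in> E" "f \<notin> E1" "f \<notin> E2" by auto
    then obtain t where t: "t \<in> {0..1}" "f = \<gamma> t" unfolding E by blast
    then have "\<not> t \<le> 1/2 - \<epsilon>" "\<not> 1/2 + \<epsilon> \<le> t" using fE by (auto simp: E1 E2)
    then have "f \<in> ball x d" using near[of t] t by auto
    moreover have "f \<in> closure U" using f by (simp add: frontier_def)
    ultimately show False using U by (metis open_Int_closure_eq_empty open_ball Int_commute disjoint_iff)
  qed
  then show thesis using that by (auto simp: U_def E_def x_def)
qed

text \<open>
  Close the arc \<open>\<gamma>\<close> by \<open>q\<close> to a simple closed curve. Since the winding number tells \<open>l\<close> from \<open>r\<close>, exactly one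
  of them is inside, and a point \<open>y'\<close> of the disc is on the same side as one of them. It is joined to that point off
  the closed curve and, within the disc, off \<open>K\<close> and the outer parts of \<open>\<gamma>\<close>. The intersection of these two
  obstacles is connected, so Janiszewski's theorem joins the two points off their union.
\<close>
lemma chord_joined_to_side:
  assumes K: "compact K" and \<gamma>: "arc \<gamma>" and K\<gamma>: "K \<inter> path_image \<gamma> = {\<gamma> 0, \<gamma> 1}"
    and q: "arc q" "path_image q \<subseteq> K" "pathstart q = pathfinish \<gamma>" "pathfinish q = pathstart \<gamma>"
    and ball: "d > 0" "ball (\<gamma> (1/2)) d \<inter> K = {}" "ball (\<gamma> (1/2)) d \<inter> outer_parts \<gamma> (1/4) = {}"
    and lr: "l \<in> ball (\<gamma> (1/2)) d" "r \<in> ball (\<gamma> (1/2)) d" "l \<notin> path_image \<gamma>" "r \<notin> path_image \<gamma>"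
      "winding_number (\<gamma> +++ q) l \<noteq> winding_number (\<gamma> +++ q) r"
    and yz: "joined_off K y z" "\<not> joined_off (K \<union> path_image \<gamma>) y z" "y \<notin> path_image \<gamma>"
  shows "joined_off (K \<union> path_image \<gamma>) y l \<or> joined_off (K \<union> path_image \<gamma>) y r"
proof -
  let ?x = "\<gamma> (1/2)" and ?E = "path_image \<gamma>"
  obtain y' where y': "joined_off (K \<union> ?E) y y'" "y' \<in> ball ?x d"
    using chord_face_near_midpoint[OF K \<gamma> K\<gamma> yz ball(1)] by blast
  define c where "c = \<gamma> +++ q"
  have ends: "pathstart \<gamma> = \<gamma> 0" "pathfinish \<gamma> = \<gamma> 1" by (simp_all add: pathstart_def pathfinish_def)
  have c: "simple_path c" "pathfinish c = pathstart c"
    using \<gamma> q K\<gamma> ends by (auto simp: c_def intro!: simple_path_join_loop)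
  have ci: "path_image c = ?E \<union> path_image q" using q by (simp add: c_def path_image_join)
  have J: "connected (inside (path_image c))" "connected (outside (path_image c))"
    using Jordan_inside_outside[OF c] by auto
  have off: "l \<notin> path_image c" "r \<notin> path_image c" "y' \<notin> path_image c"
    using lr ball q joined_off_notin[OF y'(1)] y' ci by auto
  have io: "inside (path_image c) \<inter> path_image c = {}" "outside (path_image c) \<inter> path_image c = {}"
    by (auto simp: inside_def outside_def)
  have cpath: "path c" using c by (simp add: simple_path_imp_path)
  have wn: "winding_number c v = winding_number c w" if "connected S" "v \<in> S" "w \<in> S" "S \<inter> path_image c = {}" for S v w
    using winding_number_eq[OF cpath c(2)] that by blast
  have "inside (path_image c) \<union> outside (path_image c) = - path_image c" by (rule inside_Un_outside)
  then have "l \<in> inside (path_image c) \<and> r \<in> outside (path_image c) \<or> r \<in> inside (path_image c) \<and> l \<in> outside (path_image c)"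
    using wn[OF J(1) _ _ io(1), of l r] wn[OF J(2) _ _ io(2), of l r] lr off by (fold c_def) blast
  moreover have "y' \<in> inside (path_image c) \<or> y' \<in> outside (path_image c)"
    using off inside_Un_outside[of "path_image c"] by blast
  ultimately obtain s where s: "s = l \<or> s = r" "joined_off (path_image c) y' s"
    using joined_off_connected[OF J(1) _ _ io(1)] joined_off_connected[OF J(2) _ _ io(2)] by blast
  have sb: "s \<in> ball ?x d" using s lr by auto
  let ?T = "K \<union> outer_parts \<gamma> (1/4)"
  have cont: "continuous_on {0..1} \<gamma>" using \<gamma> by (auto simp: arc_def path_def)
  have part: "connected (\<gamma> ` {a..b})" "compact (\<gamma> ` {a..b})" if "0 \<le> a" "b \<le> 1" for a b
    using that by (auto intro!: connected_continuous_image compact_continuous_image continuous_on_subset[OF cont])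
  have "joined_off (path_image c \<union> ?T) y' s"
  proof (rule Janiszewski)
    show "compact (path_image c)" using cpath by (rule compact_path_image)
    show "closed ?T"
      using K part[of 0 "1/2 - 1/4"] part[of "1/2 + 1/4" 1]
      by (auto simp: outer_parts_def intro!: closed_Un compact_imp_closed)
    show "joined_off (path_image c) y' s" by fact
    show "joined_off ?T y' s"
      using y' sb ball by (intro joined_off_connected[of "ball ?x d"]) auto
    have "path_image c \<inter> ?T = \<gamma> ` {0..1/2 - 1/4} \<union> (path_image q \<union> \<gamma> ` {1/2 + 1/4..1})"
    proof -
      have "K \<inter> ?E \<subseteq> path_image q"
        using K\<gamma> pathfinish_in_path_image[of q] pathstart_in_path_image[of q] q(3,4) ends by auto
      moreover have "outer_parts \<gamma> (1/4) \<subseteq> ?E" by (auto simp: outer_parts_def path_image_def)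
      ultimately have "(?E \<union> path_image q) \<inter> ?T = path_image q \<union> outer_parts \<gamma> (1/4)"
        using q(2) by blast
      then show ?thesis by (simp add: ci outer_parts_def Un_ac)
    qed
    moreover have "connected \<dots>"
    proof (intro connected_Un part)
      show "connected (path_image q)" using q by (simp add: connected_arc_image)
      show "path_image q \<inter> \<gamma> ` {1/2 + 1/4..1} \<noteq> {}"
        using pathstart_in_path_image[of q] q(3) ends by (auto intro!: rev_image_eqI[of 1])
      show "\<gamma> ` {0..1/2 - 1/4} \<inter> (path_image q \<union> \<gamma> ` {1/2 + 1/4..1}) \<noteq> {}"
        using pathfinish_in_path_image[of q] q(4) ends by (auto intro!: rev_image_eqI[of 0])
    qed auto
    ultimately show "connected (path_image c \<inter> ?T)" by simp
  qed
  moreover have "K \<union> ?E \<subseteq> path_image c \<union> ?T" by (auto simp: ci)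
  ultimately have "joined_off (K \<union> ?E) y' s" by (rule joined_off_antimono)
  then have "joined_off (K \<union> ?E) y s" using y'(1) by (rule connected_component_trans[rotated])
  then show ?thesis using s by auto
qed

text \<open>
  Every point of a simple closed curve is in the closure of both its inside and its outside. Which of the two
  becomes \<open>l\<close> depends on the sense in which the curve winds around its inside.
\<close>
lemma sides_of_arc_on_closed_curve:
  assumes \<gamma>: "arc \<gamma>" and q: "arc q" "pathstart q = pathfinish \<gamma>" "pathfinish q = pathstart \<gamma>"
      "path_image \<gamma> \<inter> path_image q \<subseteq> {pathstart \<gamma>, pathfinish \<gamma>}"
    and d: "d > 0" and x: "x \<in> path_image \<gamma>"
  obtains l r where "l \<in> ball x d" "r \<in> ball x d" "l \<notin> path_image \<gamma>" "r \<notin> path_image \<gamma>"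
    "l \<notin> path_image q" "r \<notin> path_image q"
    "winding_number (\<gamma> +++ q) l - winding_number (\<gamma> +++ q) r = 1"
proof -
  define c where "c = \<gamma> +++ q"
  have c: "simple_path c" "pathfinish c = pathstart c"
    using \<gamma> q by (auto simp: c_def intro!: simple_path_join_loop)
  have ci: "path_image c = path_image \<gamma> \<union> path_image q" using q by (simp add: c_def path_image_join)
  have J: "frontier (inside (path_image c)) = path_image c" "frontier (outside (path_image c)) = path_image c"
    using Jordan_inside_outside[OF c] by auto
  have "x \<in> closure (inside (path_image c))" "x \<in> closure (outside (path_image c))"
    using x ci J frontier_def[of "inside (path_image c)"] frontier_def[of "outside (path_image c)"] by auto
  then obtain i o' where i: "i \<in> inside (path_image c)" "i \<in> ball x d"
    and o': "o' \<in> outside (path_image c)" "o' \<in> ball x d"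
    using d unfolding closure_approachable mem_ball by (metis dist_commute)
  have w: "winding_number c o' = 0"
    using winding_number_zero_in_outside[of c o'] c o' by (simp add: simple_path_imp_path)
  have "winding_number c i \<in> {-1, 1}"
    using simple_closed_path_winding_number_inside[OF c(1)] i by (metis insertCI)
  moreover have "i \<notin> path_image c" "o' \<notin> path_image c" using i o' by (auto simp: inside_def outside_def)
  ultimately show thesis
    using that[of i o'] that[of o' i] i o' w unfolding c_def[symmetric] ci by auto
qed

section \<open>Digraphs drawn in the plane\<close>

lemma card_image_kernel_mono:
  assumes "finite S" and ker: "\<And>y z. y \<in> S \<Longrightarrow> z \<in> S \<Longrightarrow> q y = q z \<Longrightarrow> p y = p z"
  shows "card (p ` S) \<le> card (q ` S)"
    and "\<lbrakk>y \<in> S; z \<in> S; q y \<noteq> q z; p y = p z\<rbrakk> \<Longrightarrow> card (p ` S) < card (q ` S)"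
proof -
  define g where "g k = p (inv_into S q k)" for k
  have g: "g (q y) = p y" if "y \<in> S" for y
    using that ker[of "inv_into S q (q y)" y] by (simp add: g_def inv_into_into f_inv_into_f)
  have im: "p ` S = g ` q ` S" using g by (auto simp: image_image)
  show le: "card (p ` S) \<le> card (q ` S)"
    unfolding im using assms(1) by (intro card_image_le) auto
  assume *: "y \<in> S" "z \<in> S" "q y \<noteq> q z" "p y = p z"
  have "card (p ` S) \<noteq> card (q ` S)"
  proof
    assume "card (p ` S) = card (q ` S)"
    then have "inj_on g (q ` S)" unfolding im using assms(1) by (intro eq_card_imp_inj_on) auto
    moreover have "g (q y) = g (q z)" using * g by simp
    ultimately show False using * by (meson imageI inj_onD)
  qed
  then show "card (p ` S) < card (q ` S)" using le by simp
qed

lemma sum_fun_upd_add_mult: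
  fixes f w :: "'b \<Rightarrow> 'r::comm_ring"
  assumes "finite S" "a \<in> S"
  shows "(\<Sum>b\<in>S. (f(a := f a + s)) b * w b) = (\<Sum>b\<in>S. f b * w b) + s * w a"
proof -
  have "(\<Sum>b\<in>S. (f(a := f a + s)) b * w b) = (\<Sum>b\<in>S. f b * w b + (if b = a then s * w a else 0))"
    by (intro sum.cong) (auto simp: distrib_right)
  then show ?thesis using assms by (simp add: sum.distrib)
qed

locale drawn_digraph =
  fixes D :: "('a, 'b) pre_digraph" and pos :: "'a \<Rightarrow> complex" and \<gamma> :: "'b \<Rightarrow> real \<Rightarrow> complex"
  assumes fin: "fin_digraph D" and drawing: "plane_drawing D pos \<gamma>"
begin

lemma finite_arcs: "finite (arcs D)" and finite_verts: "finite (verts D)"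
  using fin by (simp_all add: fin_digraph.finite_arcs fin_digraph.finite_verts)

lemma ends_in_verts: "a \<in> arcs D \<Longrightarrow> tail D a \<in> verts D" "a \<in> arcs D \<Longrightarrow> head D a \<in> verts D"
  using fin by (simp_all add: fin_digraph_def wf_digraph.tail_in_verts wf_digraph.head_in_verts)

lemma curve: "a \<in> arcs D \<Longrightarrow> arc (\<gamma> a)"
    "a \<in> arcs D \<Longrightarrow> pathstart (\<gamma> a) = pos (tail D a)" "a \<in> arcs D \<Longrightarrow> pathfinish (\<gamma> a) = pos (head D a)"
  using drawing by (simp_all add: plane_drawing_def)

lemma pos_eq: "\<lbrakk>pos u = pos v; u \<in> verts D; v \<in> verts D\<rbrakk> \<Longrightarrow> u = v"
  using drawing by (auto simp: plane_drawing_def dest: inj_onD)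

lemma tail_neq_head: "a \<in> arcs D \<Longrightarrow> tail D a \<noteq> head D a"
  using curve[of a] arc_distinct_ends[of "\<gamma> a"] by auto

lemma curves_meet:
  "\<lbrakk>a \<in> arcs D; b \<in> arcs D; a \<noteq> b\<rbrakk> \<Longrightarrow>
    path_image (\<gamma> a) \<inter> path_image (\<gamma> b) \<subseteq> pos ` ({tail D a, head D a} \<inter> {tail D b, head D b})"
  using drawing unfolding plane_drawing_def by blast

definition drawn :: "'b set \<Rightarrow> complex set" where
  "drawn A = (\<Union>a\<in>A. path_image (\<gamma> a))"

lemma compact_drawn: "A \<subseteq> arcs D \<Longrightarrow> compact (drawn A)"
  unfolding drawn_def using finite_arcs curve
  by (intro compact_UN) (auto intro: finite_subset compact_arc_image)

lemma drawn_insert: "drawn (insert e A) = drawn A \<union> path_image (\<gamma> e)"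
  by (auto simp: drawn_def)

lemma drawn_mono: "A \<subseteq> B \<Longrightarrow> drawn A \<subseteq> drawn B"
  by (auto simp: drawn_def)

lemma curve_meets_drawn:
  assumes "A \<subseteq> arcs D" "e \<in> arcs D" "e \<notin> A"
  shows "drawn A \<inter> path_image (\<gamma> e) \<subseteq> {pos (tail D e), pos (head D e)}"
  using curves_meet assms unfolding drawn_def by fastforce

text \<open>
  Walks that may use arcs of \<open>A\<close> against their direction. The function records how often each arc is
  traversed, backward traversals counting negatively; it is complex because it multiplies winding numbers.
\<close>
inductive uwalk :: "'b set \<Rightarrow> 'a \<Rightarrow> ('b \<Rightarrow> complex) \<Rightarrow> 'a \<Rightarrow> bool" for A u where
  nil: "uwalk A u (\<lambda>_. 0) u"
| fwd: "\<lbrakk>uwalk A u f (tail D a); a \<in> A\<rbrakk> \<Longrightarrow> uwalk A u (f(a := f a + 1)) (head D a)"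
| bwd: "\<lbrakk>uwalk A u f (head D a); a \<in> A\<rbrakk> \<Longrightarrow> uwalk A u (f(a := f a + (-1))) (tail D a)"

lemma uwalk_support: "uwalk A u f v \<Longrightarrow> a \<notin> A \<Longrightarrow> f a = 0"
  by (induction rule: uwalk.induct) auto

lemma uwalk_mono: "uwalk A u f v \<Longrightarrow> A \<subseteq> B \<Longrightarrow> uwalk B u f v"
  by (induction rule: uwalk.induct) (blast intro: uwalk.intros)+

definition inc :: "'a \<Rightarrow> 'b \<Rightarrow> complex" where
  "inc x a = of_bool (head D a = x) - of_bool (tail D a = x)"

lemma uwalk_boundary:
  assumes "uwalk A u f v" "A \<subseteq> arcs D"
  shows "(\<Sum>a\<in>arcs D. f a * inc x a) = of_bool (v = x) - of_bool (u = x)"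
  using assms
proof (induction rule: uwalk.induct)
  case (fwd f a)
  then show ?case by (subst sum_fun_upd_add_mult) (use finite_arcs in \<open>auto simp: inc_def\<close>)
next
  case (bwd f a)
  then show ?case by (subst sum_fun_upd_add_mult) (use finite_arcs in \<open>auto simp: inc_def\<close>)
qed auto

text \<open>
  For the traversal function of a closed walk this is the winding number of the closed curve obtained by
  drawing arc \<open>a\<close> as \<open>c a\<close>. The curves are a parameter because the jump across an arc is computed by redrawing that arc.
\<close>
definition wind :: "('b \<Rightarrow> real \<Rightarrow> complex) \<Rightarrow> ('b \<Rightarrow> complex) \<Rightarrow> complex \<Rightarrow> complex" where
  "wind c f z = (\<Sum>a\<in>arcs D. f a * winding_number (c a) z)"

text \<open>
  The trivial walk needs a case of its own: its curve would be a vertex, which need not lie on any curve of \<open>A\<close>.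
\<close>
lemma uwalk_path:
  assumes c: "\<And>a. a \<in> A \<Longrightarrow> path (c a)" "\<And>a. a \<in> A \<Longrightarrow> pathstart (c a) = pos (tail D a)"
      "\<And>a. a \<in> A \<Longrightarrow> pathfinish (c a) = pos (head D a)"
    and W: "uwalk A u f v" and A: "A \<subseteq> arcs D"
  shows "(f = (\<lambda>_. 0) \<and> u = v) \<or> (\<exists>\<kappa>. path \<kappa> \<and> pathstart \<kappa> = pos u \<and> pathfinish \<kappa> = pos v \<and>
    path_image \<kappa> \<subseteq> (\<Union>a\<in>A. path_image (c a)) \<and>
    (\<forall>z. z \<notin> (\<Union>a\<in>A. path_image (c a)) \<longrightarrow> winding_number \<kappa> z = wind c f z))"
    (is "_ \<or> (\<exists>\<kappa>. ?P f v \<kappa>)")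
proof -
  have step: "\<exists>\<kappa>. ?P (f(a := f a + s)) w \<kappa>"
    if IH: "(f = (\<lambda>_. 0) \<and> u = v) \<or> (\<exists>\<kappa>. ?P f v \<kappa>)" and a: "a \<in> A"
      and p: "path p" "pathstart p = pos v" "pathfinish p = pos w" "path_image p = path_image (c a)"
        "\<And>z. z \<notin> path_image (c a) \<Longrightarrow> winding_number p z = s * winding_number (c a) z"
    for f v a s p w
  proof -
    have wd: "wind c (f(a := f a + s)) z = wind c f z + s * winding_number (c a) z" for z
      unfolding wind_def using a A finite_arcs by (intro sum_fun_upd_add_mult) auto
    from IH show ?thesis
    proof
      assume "f = (\<lambda>_. 0) \<and> u = v"
      then have "?P (f(a := f a + s)) w p"
        using p a unfolding wd by (auto simp: wind_def)
      then show ?thesis by blast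
    next
      assume "\<exists>\<kappa>. ?P f v \<kappa>"
      then obtain \<kappa> where k: "?P f v \<kappa>" by blast
      have "?P (f(a := f a + s)) w (\<kappa> +++ p)"
      proof (intro conjI allI impI)
        fix z assume z: "z \<notin> (\<Union>a\<in>A. path_image (c a))"
        then have "z \<notin> path_image \<kappa>" "z \<notin> path_image p" using k p(4) a by auto
        then show "winding_number (\<kappa> +++ p) z = wind c (f(a := f a + s)) z"
          unfolding wd using k p z a by (subst winding_number_join) auto
      qed (use k p a in \<open>auto simp: path_image_join\<close>)
      then show ?thesis by blast
    qed
  qed
  from W show ?thesis
  proof (induction rule: uwalk.induct)
    case (fwd f a)
    then show ?case using step[OF fwd.IH fwd.hyps(2), of "c a" "head D a" 1] c by auto
  next
    case (bwd f a)
    have "winding_number (reversepath (c a)) z = -1 * winding_number (c a) z"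
      if "z \<notin> path_image (c a)" for z using c[OF bwd.hyps(2)] that by (simp add: winding_number_reversepath)
    then show ?case using step[OF bwd.IH bwd.hyps(2), of "reversepath (c a)" "tail D a" "-1"] c[OF bwd.hyps(2)] by auto
  qed auto
qed

lemma wind_locally_constant:
  assumes W: "uwalk A u f u" and A: "A \<subseteq> arcs D" and yz: "joined_off (drawn A) y z"
  shows "wind \<gamma> f y = wind \<gamma> f z"
proof -
  have "f = (\<lambda>_. 0) \<or> (\<exists>\<kappa>. path \<kappa> \<and> pathstart \<kappa> = pos u \<and> pathfinish \<kappa> = pos u \<and>
    path_image \<kappa> \<subseteq> drawn A \<and> (\<forall>z. z \<notin> drawn A \<longrightarrow> winding_number \<kappa> z = wind \<gamma> f z))"
    using uwalk_path[of A \<gamma>, OF _ _ _ W A] curve A by (auto simp: drawn_def arc_imp_path subset_iff)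
  then show ?thesis
  proof
    assume "\<exists>\<kappa>. path \<kappa> \<and> pathstart \<kappa> = pos u \<and> pathfinish \<kappa> = pos u \<and>
      path_image \<kappa> \<subseteq> drawn A \<and> (\<forall>z. z \<notin> drawn A \<longrightarrow> winding_number \<kappa> z = wind \<gamma> f z)"
    then obtain \<kappa> where k: "path \<kappa>" "pathfinish \<kappa> = pathstart \<kappa>" "path_image \<kappa> \<subseteq> drawn A"
      "\<And>z. z \<notin> drawn A \<Longrightarrow> winding_number \<kappa> z = wind \<gamma> f z" by auto
    have "winding_number \<kappa> y = winding_number \<kappa> z"
      using winding_number_joined_off[OF k(1,2) yz k(3)] .
    then show ?thesis using k(4) joined_off_notin[OF yz] by auto
  qed (simp add: wind_def)
qed

definition linked :: "'b set \<Rightarrow> ('a \<times> 'a) set" where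
  "linked A = ((\<lambda>a. (tail D a, head D a)) ` A \<union> (\<lambda>a. (head D a, tail D a)) ` A)\<^sup>*"

lemma linked_sym: "(u, v) \<in> linked A \<Longrightarrow> (v, u) \<in> linked A"
proof -
  have "sym (linked A)" unfolding linked_def by (intro sym_rtrancl symI) auto
  then show "(u, v) \<in> linked A \<Longrightarrow> (v, u) \<in> linked A" by (rule symD)
qed

lemma linked_trans: "(u, v) \<in> linked A \<Longrightarrow> (v, w) \<in> linked A \<Longrightarrow> (u, w) \<in> linked A"
  unfolding linked_def by (rule rtrancl_trans)

lemma linked_refl: "(u, u) \<in> linked A"
  unfolding linked_def by blast

lemma linked_mono: "A \<subseteq> B \<Longrightarrow> linked A \<subseteq> linked B"
  unfolding linked_def by (intro rtrancl_mono) auto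

lemma linked_ends: "a \<in> A \<Longrightarrow> (tail D a, head D a) \<in> linked A"
  unfolding linked_def by (intro r_into_rtrancl) auto

lemma linked_uwalk:
  assumes "(u, v) \<in> linked A"
  obtains f where "uwalk A u f v"
proof -
  have "\<exists>f. uwalk A u f v"
    using assms unfolding linked_def
    by (induction rule: rtrancl_induct) (auto intro: uwalk.intros)
  then show thesis using that by blast
qed

lemma linked_arc:
  assumes uv: "(u, v) \<in> linked A" "u \<noteq> v" "u \<in> verts D" "v \<in> verts D" and A: "A \<subseteq> arcs D"
  obtains q where "arc q" "path_image q \<subseteq> drawn A" "pathstart q = pos u" "pathfinish q = pos v"
proof -
  obtain f where W: "uwalk A u f v" using linked_uwalk[OF uv(1)] .
  have "\<exists>\<kappa>. path \<kappa> \<and> pathstart \<kappa> = pos u \<and> pathfinish \<kappa> = pos v \<and> path_image \<kappa> \<subseteq> drawn A"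
    using uwalk_path[of A \<gamma>, OF _ _ _ W A] curve A uv(2) by (auto simp: drawn_def arc_imp_path subset_iff)
  then obtain \<kappa> where k: "path \<kappa>" "pathstart \<kappa> = pos u" "pathfinish \<kappa> = pos v" "path_image \<kappa> \<subseteq> drawn A"
    by blast
  have "pos u \<noteq> pos v" using pos_eq uv by blast
  then show thesis
    using path_contains_arc[OF k(1-3)] that k(4) by (metis order_trans)
qed

text \<open>
  The part of the drawing linked to the tail of \<open>e\<close> and the rest are disjoint, and \<open>e\<close> is a bridge between them.
\<close>
lemma joined_off_unlinked_arc:
  assumes A: "A \<subseteq> arcs D" and e: "e \<in> arcs D" "e \<notin> A" and un: "(tail D e, head D e) \<notin> linked A"
    and yz: "joined_off (drawn A) y z" "y \<notin> path_image (\<gamma> e)" "z \<notin> path_image (\<gamma> e)"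
  shows "joined_off (drawn (insert e A)) y z"
proof -
  define A1 where "A1 = {a \<in> A. (tail D e, tail D a) \<in> linked A}"
  have A1: "A1 \<subseteq> A" by (auto simp: A1_def)
  have A1': "(tail D e, x) \<in> linked A" if "a \<in> A1" "x \<in> {tail D a, head D a}" for a x
    using that linked_trans[of "tail D e" "tail D a" A x] linked_ends[of a A] by (auto simp: A1_def)
  have A2': "(tail D e, x) \<notin> linked A" if "a \<in> A - A1" "x \<in> {tail D a, head D a}" for a x
    using that linked_trans[of "tail D e" x A "tail D a"] linked_sym[OF linked_ends[of a A]] by (auto simp: A1_def)
  have K: "drawn A1 \<union> drawn (A - A1) = drawn A" using A1 by (auto simp: drawn_def)
  have "joined_off (drawn A1 \<union> drawn (A - A1) \<union> path_image (\<gamma> e)) y z"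
  proof (rule joined_off_bridge_arc)
    show "compact (drawn A1)" "compact (drawn (A - A1))" using A A1 by (auto intro!: compact_drawn)
    show "arc (\<gamma> e)" using e curve by simp
    show "drawn A1 \<inter> drawn (A - A1) = {}"
    proof (rule ccontr)
      assume "drawn A1 \<inter> drawn (A - A1) \<noteq> {}"
      then obtain a b p where ab: "a \<in> A1" "b \<in> A - A1" "p \<in> path_image (\<gamma> a) \<inter> path_image (\<gamma> b)"
        by (auto simp: drawn_def)
      then have "p \<in> pos ` ({tail D a, head D a} \<inter> {tail D b, head D b})"
        using curves_meet[of a b] A A1 by blast
      then show False using A1'[OF ab(1)] A2'[OF ab(2)] by blast
    qed
    have meet: "\<exists>a\<in>B. \<exists>w\<in>{tail D e, head D e} \<inter> {tail D a, head D a}. p = pos w"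
      if "p \<in> drawn B \<inter> path_image (\<gamma> e)" "B \<subseteq> A" for p B
      using that curves_meet[of _ e] e A unfolding drawn_def by blast
    show "drawn A1 \<inter> path_image (\<gamma> e) \<subseteq> {pos (tail D e)}"
    proof
      fix p assume "p \<in> drawn A1 \<inter> path_image (\<gamma> e)"
      from meet[OF this A1] show "p \<in> {pos (tail D e)}" using A1' un by fast
    qed
    show "drawn (A - A1) \<inter> path_image (\<gamma> e) \<subseteq> {pos (head D e)}"
    proof
      fix p assume "p \<in> drawn (A - A1) \<inter> path_image (\<gamma> e)"
      from meet[OF this] show "p \<in> {pos (head D e)}" using A2' linked_refl by fast
    qed
  qed (use yz K in auto)
  then show ?thesis by (simp add: K drawn_insert)
qed

end

text \<open>
  Every arc \<open>e\<close> comes with a disc around its midpoint that meets nothing of the drawing except the middle part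
  of \<open>e\<close>, and with points \<open>l e\<close> and \<open>r e\<close> in this disc to its left and right. Left and right are told apart by the winding
  number of a closed curve through \<open>e\<close> whose other part \<open>Q e\<close> stays in the drawing without \<open>e\<close>.
\<close>
locale sided_drawing = drawn_digraph +
  fixes l r :: "'b \<Rightarrow> complex" and Q :: "'b \<Rightarrow> real \<Rightarrow> complex" and d :: "'b \<Rightarrow> real"
  assumes Q: "e \<in> arcs D \<Longrightarrow> path (Q e)" "e \<in> arcs D \<Longrightarrow> pathstart (Q e) = pos (head D e)"
      "e \<in> arcs D \<Longrightarrow> pathfinish (Q e) = pos (tail D e)"
      "e \<in> arcs D \<Longrightarrow> path_image (Q e) \<subseteq> drawn (arcs D - {e})"
    and d: "e \<in> arcs D \<Longrightarrow> d e > 0" "e \<in> arcs D \<Longrightarrow> ball (\<gamma> e (1/2)) (d e) \<inter> drawn (arcs D - {e}) = {}"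
      "e \<in> arcs D \<Longrightarrow> ball (\<gamma> e (1/2)) (d e) \<inter> outer_parts (\<gamma> e) (1/4) = {}"
    and lr: "e \<in> arcs D \<Longrightarrow> l e \<in> ball (\<gamma> e (1/2)) (d e)" "e \<in> arcs D \<Longrightarrow> r e \<in> ball (\<gamma> e (1/2)) (d e)"
      "e \<in> arcs D \<Longrightarrow> l e \<notin> path_image (\<gamma> e)" "e \<in> arcs D \<Longrightarrow> r e \<notin> path_image (\<gamma> e)"
    and jump: "e \<in> arcs D \<Longrightarrow> winding_number (\<gamma> e +++ Q e) (l e) - winding_number (\<gamma> e +++ Q e) (r e) = 1"
begin

text \<open>
  Redraw \<open>e\<close> as the reverse of \<open>Q e\<close>. The walk then avoids the disc of \<open>e\<close>, so its winding number is the same at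
  \<open>l e\<close> and \<open>r e\<close>. Redrawing changes the winding number by that of \<open>\<gamma> e +++ Q e\<close> for each traversal of \<open>e\<close>.
\<close>
lemma wind_jump:
  assumes W: "uwalk A u f u" and A: "A \<subseteq> arcs D" and e: "e \<in> arcs D"
  shows "wind \<gamma> f (l e) - wind \<gamma> f (r e) = f e"
proof -
  define c where "c = \<gamma>(e := reversepath (Q e))"
  let ?B = "ball (\<gamma> e (1/2)) (d e)"
  have "f = (\<lambda>_. 0) \<or> (\<exists>\<kappa>. path \<kappa> \<and> pathfinish \<kappa> = pathstart \<kappa> \<and> path_image \<kappa> \<subseteq> drawn (arcs D - {e}) \<and>
      (\<forall>z\<in>?B. winding_number \<kappa> z = wind c f z))"
  proof -
    have c: "path (c a)" "pathstart (c a) = pos (tail D a)" "pathfinish (c a) = pos (head D a)"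
        "path_image (c a) \<subseteq> drawn (arcs D - {e})" if "a \<in> A" for a
      using that A curve[of a] Q[OF e] by (auto simp: c_def arc_imp_path drawn_def)
    have "(\<Union>a\<in>A. path_image (c a)) \<subseteq> drawn (arcs D - {e})" using c(4) by blast
    moreover from this have "z \<notin> (\<Union>a\<in>A. path_image (c a))" if "z \<in> ?B" for z using d(2)[OF e] that by blast
    ultimately show ?thesis
      using uwalk_path[of A c, OF c(1-3) W A] by (metis (no_types, lifting) order_trans)
  qed
  then show ?thesis
  proof
    assume "\<exists>\<kappa>. path \<kappa> \<and> pathfinish \<kappa> = pathstart \<kappa> \<and> path_image \<kappa> \<subseteq> drawn (arcs D - {e}) \<and>
      (\<forall>z\<in>?B. winding_number \<kappa> z = wind c f z)"
    then obtain \<kappa> where k: "path \<kappa>" "pathfinish \<kappa> = pathstart \<kappa>" "path_image \<kappa> \<subseteq> drawn (arcs D - {e})"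
      "\<And>z. z \<in> ?B \<Longrightarrow> winding_number \<kappa> z = wind c f z" by blast
    have "winding_number \<kappa> (l e) = winding_number \<kappa> (r e)"
      using k lr[OF e] d(2)[OF e] by (intro winding_number_eq[of _ _ ?B]) auto
    then have same: "wind c f (l e) = wind c f (r e)" using k(4) lr[OF e] by simp
    have diff: "wind \<gamma> f z = wind c f z + f e * winding_number (\<gamma> e +++ Q e) z"
      if z: "z \<in> ?B" "z \<notin> path_image (\<gamma> e)" for z
    proof -
      have "z \<notin> path_image (Q e)" using z d(2)[OF e] Q(4)[OF e] by blast
      then have "winding_number (\<gamma> e +++ Q e) z = winding_number (\<gamma> e) z + winding_number (Q e) z"
        "winding_number (c e) z = - winding_number (Q e) z"
        using z curve[OF e] Q[OF e] by (auto simp: winding_number_join arc_imp_path c_def winding_number_reversepath)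
      moreover have "wind \<gamma> f z = f e * winding_number (\<gamma> e) z + (\<Sum>a\<in>arcs D - {e}. f a * winding_number (\<gamma> a) z)"
        "wind c f z = f e * winding_number (c e) z + (\<Sum>a\<in>arcs D - {e}. f a * winding_number (\<gamma> a) z)"
        unfolding wind_def using e finite_arcs by (simp_all add: sum.remove[of _ e] c_def)
      ultimately show ?thesis by (simp add: algebra_simps)
    qed
    have "wind \<gamma> f (l e) - wind \<gamma> f (r e)
        = f e * (winding_number (\<gamma> e +++ Q e) (l e) - winding_number (\<gamma> e +++ Q e) (r e))"
      using diff[of "l e"] diff[of "r e"] same lr[OF e] by (simp add: algebra_simps)
    then show ?thesis using jump[OF e] by simp
  qed (simp add: wind_def)
qed

text \<open>
  Faces are only ever looked at through these finitely many points.
\<close>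
definition pts :: "complex set" where
  "pts = l ` arcs D \<union> r ` arcs D"

lemma side_off: "e \<in> arcs D \<Longrightarrow> l e \<notin> drawn (arcs D) \<and> r e \<notin> drawn (arcs D)"
  using lr d(2) unfolding drawn_def by blast

lemma pts_off: "y \<in> pts \<Longrightarrow> y \<notin> drawn (arcs D)"
  using side_off by (auto simp: pts_def)

lemma pts_off_curve: "y \<in> pts \<Longrightarrow> e \<in> arcs D \<Longrightarrow> y \<notin> path_image (\<gamma> e)"
  using pts_off by (auto simp: drawn_def)

lemma lr_pts: "e \<in> arcs D \<Longrightarrow> l e \<in> pts" "e \<in> arcs D \<Longrightarrow> r e \<in> pts"
  by (auto simp: pts_def)

lemma sides_joined_before:
  assumes "A \<subseteq> arcs D" "e \<in> arcs D" "e \<notin> A"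
  shows "joined_off (drawn A) (l e) (r e)"
proof -
  have "drawn A \<subseteq> drawn (arcs D - {e})" using assms by (intro drawn_mono) auto
  then show ?thesis using assms lr d(2)[of e]
    by (intro joined_off_connected[of "ball (\<gamma> e (1/2)) (d e)"]) auto
qed

lemma chord_cycle:
  assumes A: "A \<subseteq> arcs D" and e: "e \<in> arcs D" "e \<notin> A" and li: "(tail D e, head D e) \<in> linked A"
  obtains f where "uwalk (insert e A) (head D e) f (head D e)" "f e = 1"
proof -
  obtain f where f: "uwalk A (head D e) f (tail D e)"
    using linked_uwalk[OF linked_sym[OF li]] .
  then have "uwalk (insert e A) (head D e) (f(e := f e + 1)) (head D e)"
    by (intro uwalk.fwd uwalk_mono[OF f]) auto
  moreover have "f e = 0" using uwalk_support[OF f e(2)] .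
  ultimately show thesis using that by force
qed

text \<open>
  The winding number difference of one between \<open>l e\<close> and \<open>r e\<close> does not depend on how \<open>\<gamma> e\<close> is closed up: two
  return paths in the drawing without \<open>e\<close> form a closed curve that avoids the disc of \<open>e\<close>.
\<close>
lemma chord_face_split:
  assumes A: "A \<subseteq> arcs D" and e: "e \<in> arcs D" "e \<notin> A" and li: "(tail D e, head D e) \<in> linked A"
    and yz: "joined_off (drawn A) y z" "\<not> joined_off (drawn (insert e A)) y z" "y \<in> pts"
  shows "joined_off (drawn (insert e A)) y (l e) \<or> joined_off (drawn (insert e A)) y (r e)"
proof -
  obtain q where q: "arc q" "path_image q \<subseteq> drawn A" "pathstart q = pos (head D e)" "pathfinish q = pos (tail D e)"
    using linked_arc[OF linked_sym[OF li]] tail_neq_head[OF e(1)] ends_in_verts e A by metis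
  have ends: "\<gamma> e 0 = pos (tail D e)" "\<gamma> e 1 = pos (head D e)"
    using curve[OF e(1)] by (simp_all add: pathstart_def pathfinish_def)
  have AD: "A \<subseteq> arcs D - {e}" using A e by auto
  have off: "ball (\<gamma> e (1/2)) (d e) \<inter> drawn A = {}"
    using d(2)[OF e(1)] drawn_mono[OF AD] by blast
  have sub: "drawn A \<inter> path_image (\<gamma> e) \<subseteq> {\<gamma> e 0, \<gamma> e 1}"
    using curve_meets_drawn[OF A e] unfolding ends .
  have "\<gamma> e 0 \<in> drawn A" "\<gamma> e 1 \<in> drawn A"
    using q pathstart_in_path_image[of q] pathfinish_in_path_image[of q] unfolding ends by auto
  moreover have "\<gamma> e 0 \<in> path_image (\<gamma> e)" "\<gamma> e 1 \<in> path_image (\<gamma> e)"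
    by (simp_all add: path_image_def)
  ultimately have meet: "drawn A \<inter> path_image (\<gamma> e) = {\<gamma> e 0, \<gamma> e 1}" using sub by blast
  have "winding_number (\<gamma> e +++ q) (l e) - winding_number (\<gamma> e +++ q) (r e) = 1"
  proof -
    let ?B = "ball (\<gamma> e (1/2)) (d e)"
    have same: "winding_number (q +++ reversepath (Q e)) (l e) = winding_number (q +++ reversepath (Q e)) (r e)"
    proof (rule winding_number_eq[of _ _ ?B])
      have "path_image (q +++ reversepath (Q e)) \<subseteq> drawn A \<union> drawn (arcs D - {e})"
        using q Q[OF e(1)] by (auto simp: path_image_join)
      then show "?B \<inter> path_image (q +++ reversepath (Q e)) = {}" using off d(2)[OF e(1)] by blast
    qed (use q Q[OF e(1)] lr[OF e(1)] in \<open>auto simp: arc_imp_path\<close>)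
    have "winding_number (\<gamma> e +++ q) z
        = winding_number (\<gamma> e +++ Q e) z + winding_number (q +++ reversepath (Q e)) z"
      if z: "z \<in> ?B" "z \<notin> path_image (\<gamma> e)" for z
    proof -
      have "z \<notin> path_image (Q e)" "z \<notin> path_image q" using z d(2)[OF e(1)] Q(4)[OF e(1)] off q by blast+
      then show ?thesis
        using z curve[OF e(1)] Q[OF e(1)] q
        by (simp add: winding_number_join arc_imp_path winding_number_reversepath)
    qed
    then show ?thesis using same jump[OF e(1)] lr[OF e(1)] by simp
  qed
  then have "winding_number (\<gamma> e +++ q) (l e) \<noteq> winding_number (\<gamma> e +++ q) (r e)" by auto
  then show ?thesis
    unfolding drawn_insert
    using chord_joined_to_side[OF compact_drawn[OF A] curve(1)[OF e(1)] meet q(1,2) _ _ d(1)[OF e(1)] off d(3)[OF e(1)] lr[OF e(1)]]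
      yz q(3,4) curve[OF e(1)] pts_off_curve[OF yz(3) e(1)] by (simp add: drawn_insert)
qed

end

section \<open>Drawing the arcs one at a time\<close>

context sided_drawing
begin

definition face_const :: "(complex \<Rightarrow> 'z) \<Rightarrow> 'b set \<Rightarrow> bool" where
  "face_const h A \<longleftrightarrow> (\<forall>y\<in>pts. \<forall>z\<in>pts. joined_off (drawn A) y z \<longrightarrow> h y = h z)"

text \<open>
  The function passes to the coarser faces of \<open>A\<close>, since adding \<open>e\<close> either changes no face or splits one into the faces
  of \<open>l e\<close> and \<open>r e\<close>.
\<close>
lemma face_const_descend:
  assumes A: "A \<subseteq> arcs D" and e: "e \<in> arcs D" "e \<notin> A" and h: "face_const h (insert e A)"
    and eq: "(tail D e, head D e) \<in> linked A \<Longrightarrow> h (l e) = h (r e)"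
  shows "face_const h A"
  unfolding face_const_def
proof (intro ballI impI)
  fix y z assume yz: "y \<in> pts" "z \<in> pts" "joined_off (drawn A) y z"
  have zy: "joined_off (drawn A) z y" using yz(3) by (rule connected_component_sym)
  have hh: "h v = h w" if "joined_off (drawn (insert e A)) v w" "v \<in> pts" "w \<in> pts" for v w
    using h that by (auto simp: face_const_def)
  show "h y = h z"
  proof (cases "joined_off (drawn (insert e A)) y z")
    case False
    then have False': "\<not> joined_off (drawn (insert e A)) z y" using connected_component_sym by blast
    have li: "(tail D e, head D e) \<in> linked A"
      using joined_off_unlinked_arc[OF A e _ yz(3)] False yz pts_off_curve e by blast
    have near: "h v = h (l e)" if "v \<in> pts" "joined_off (drawn (insert e A)) v (l e) \<or> joined_off (drawn (insert e A)) v (r e)" for v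
      using that hh lr_pts[OF e(1)] eq[OF li] by metis
    show ?thesis
      using near[OF yz(1) chord_face_split[OF A e li yz(3) False yz(1)]]
        near[OF yz(2) chord_face_split[OF A e li zy False' yz(2)]] by simp
  qed (use hh yz in auto)
qed

lemma jumpless_imp_const:
  assumes "A \<subseteq> arcs D" "face_const h A" "\<And>a. a \<in> A \<Longrightarrow> h (l a) = h (r a)" "y \<in> pts" "z \<in> pts"
  shows "h y = h z"
proof -
  have "finite A" using assms(1) finite_arcs by (rule finite_subset)
  then show ?thesis using assms
  proof (induction A rule: finite_induct)
    case empty
    have "joined_off (drawn {}) y z"
      by (rule joined_off_connected[of UNIV]) (auto simp: drawn_def)
    then show ?case using empty by (auto simp: face_const_def)
  next
    case (insert e A)
    then show ?case using face_const_descend[of A e h] by auto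
  qed
qed

text \<open>
  If \<open>e\<close> closes a walk, then a multiple of the winding number of that walk can be subtracted from \<open>h\<close> to remove the
  jump at \<open>e\<close>. The remainder is a function on the faces of \<open>A\<close>, and the jumps of the winding number
  are the traversal numbers of a closed walk.
\<close>
lemma face_jumps_circulation:
  fixes h :: "complex \<Rightarrow> complex"
  assumes "A \<subseteq> arcs D" "face_const h A"
  shows "(\<Sum>a\<in>A. (h (l a) - h (r a)) * inc x a) = 0"
proof -
  have "finite A" using assms(1) finite_arcs by (rule finite_subset)
  then show ?thesis using assms
  proof (induction A arbitrary: h rule: finite_induct)
    case (insert e A)
    have A: "A \<subseteq> arcs D" and e: "e \<in> arcs D" "e \<notin> A" using insert by auto
    show ?case
    proof (cases "(tail D e, head D e) \<in> linked A")
      case True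
      obtain f where f: "uwalk (insert e A) (head D e) f (head D e)" "f e = 1"
        using chord_cycle[OF A e True] .
      define t where "t = h (l e) - h (r e)"
      define h' where "h' z = h z - t * wind \<gamma> f z" for z
      have jf: "wind \<gamma> f (l a) - wind \<gamma> f (r a) = f a" if "a \<in> arcs D" for a
        using wind_jump[OF f(1) insert.prems(1) that] .
      have h': "h (l a) - h (r a) = (h' (l a) - h' (r a)) + t * f a" if "a \<in> arcs D" for a
        using jf[OF that] by (auto simp: h'_def algebra_simps)
      have e0: "h' (l e) - h' (r e) = 0" using h'[OF e(1)] f(2) by (simp add: t_def)
      have "face_const h' (insert e A)"
        using insert.prems(2) wind_locally_constant[OF f(1) insert.prems(1)]
        unfolding face_const_def h'_def by metis
      then have "face_const h' A" using face_const_descend[OF A e] e0 by simp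
      then have IH: "(\<Sum>a\<in>A. (h' (l a) - h' (r a)) * inc x a) = 0" using insert.IH[OF A] by blast
      have "(\<Sum>a\<in>insert e A. f a * inc x a) = (\<Sum>a\<in>arcs D. f a * inc x a)"
        using insert.prems(1) finite_arcs uwalk_support[OF f(1)] by (intro sum.mono_neutral_left) auto
      also have "\<dots> = 0" using uwalk_boundary[OF f(1) insert.prems(1)] by simp
      finally have fc: "(\<Sum>a\<in>insert e A. f a * inc x a) = 0" .
      have "(\<Sum>a\<in>insert e A. (h (l a) - h (r a)) * inc x a)
          = (\<Sum>a\<in>insert e A. (h' (l a) - h' (r a)) * inc x a + t * (f a * inc x a))"
      proof (rule sum.cong[OF refl])
        fix a assume "a \<in> insert e A"
        then have "a \<in> arcs D" using insert.prems(1) by blast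
        from h'[OF this] show "(h (l a) - h (r a)) * inc x a = (h' (l a) - h' (r a)) * inc x a + t * (f a * inc x a)"
          by (simp only: distrib_right mult.assoc)
      qed
      also have "\<dots> = (\<Sum>a\<in>insert e A. (h' (l a) - h' (r a)) * inc x a) + t * (\<Sum>a\<in>insert e A. f a * inc x a)"
        by (simp only: sum.distrib sum_distrib_left)
      also have "\<dots> = 0" using fc IH e0 insert.hyps by simp
      finally show ?thesis .
    next
      case False
      then have hA: "face_const h A" using face_const_descend[OF A e insert.prems(2)] by simp
      then have "h (l e) = h (r e)"
        using sides_joined_before[OF A e] lr_pts[OF e(1)] by (auto simp: face_const_def)
      then show ?thesis using insert.IH[OF A hA] insert.hyps by simp
    qed
  qed simp
qed

definition face :: "'b set \<Rightarrow> complex \<Rightarrow> complex set" where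
  "face A z = connected_component_set (- drawn A) z"

lemma face_eq:
  assumes "A \<subseteq> arcs D" "y \<in> pts" "z \<in> pts"
  shows "face A y = face A z \<longleftrightarrow> joined_off (drawn A) y z"
proof -
  have "y \<notin> drawn A" "z \<notin> drawn A" using assms pts_off drawn_mono by blast+
  then show ?thesis by (simp add: face_def connected_component_eq_eq)
qed

lemma finite_pts: "finite pts"
  by (simp add: pts_def finite_arcs)

lemma sides_separated_after:
  assumes A: "A \<subseteq> arcs D" and e: "e \<in> arcs D" "e \<notin> A" and li: "(tail D e, head D e) \<in> linked A"
  shows "\<not> joined_off (drawn (insert e A)) (l e) (r e)"
proof
  assume j: "joined_off (drawn (insert e A)) (l e) (r e)"
  obtain f where f: "uwalk (insert e A) (head D e) f (head D e)" "f e = 1"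
    using chord_cycle[OF A e li] .
  have "insert e A \<subseteq> arcs D" using A e by simp
  from wind_jump[OF f(1) this e(1)] wind_locally_constant[OF f(1) this j] f(2) show False by simp
qed

lemma linked_class_eq: "linked A `` {u} = linked A `` {v} \<longleftrightarrow> (u, v) \<in> linked A"
  using linked_trans linked_sym linked_refl by blast

text \<open>
  Euler's inequality. Each arc either separates its two sides or merges two classes of linked vertices.
\<close>
lemma face_count:
  assumes A: "A \<subseteq> arcs D" and ne: "arcs D \<noteq> {}"
  shows "1 + card A + card ((\<lambda>v. linked A `` {v}) ` verts D) \<le> card (face A ` pts) + card (verts D)"
proof -
  have "finite A" using assms(1) finite_arcs by (rule finite_subset)
  then show ?thesis using A
  proof (induction A rule: finite_induct)
    case empty
    have "face {} ` pts = {UNIV}" using ne by (auto simp: face_def drawn_def pts_def)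
    then show ?case using card_image_le[OF finite_verts, of "\<lambda>v. linked {} `` {v}"] by simp
  next
    case (insert e A)
    have A: "A \<subseteq> arcs D" and e: "e \<in> arcs D" "e \<notin> A" using insert by auto
    have fker: "face A y = face A z" if "y \<in> pts" "z \<in> pts" "face (insert e A) y = face (insert e A) z" for y z
      using that face_eq[OF A] face_eq[OF insert.prems] joined_off_antimono[OF _ drawn_mono[of A "insert e A"]] by blast
    have lker: "linked (insert e A) `` {u} = linked (insert e A) `` {v}"
      if "u \<in> verts D" "v \<in> verts D" "linked A `` {u} = linked A `` {v}" for u v
      using that linked_mono[of A "insert e A"] unfolding linked_class_eq by blast
    have f_le: "card (face A ` pts) \<le> card (face (insert e A) ` pts)"
      by (rule card_image_kernel_mono(1)[OF finite_pts]) (fact fker)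
    have l_le: "card ((\<lambda>v. linked (insert e A) `` {v}) ` verts D) \<le> card ((\<lambda>v. linked A `` {v}) ` verts D)"
      by (rule card_image_kernel_mono(1)[OF finite_verts]) (fact lker)
    have "card (face A ` pts) < card (face (insert e A) ` pts) \<or>
       card ((\<lambda>v. linked (insert e A) `` {v}) ` verts D) < card ((\<lambda>v. linked A `` {v}) ` verts D)"
    proof (cases "(tail D e, head D e) \<in> linked A")
      case True
      have "card (face A ` pts) < card (face (insert e A) ` pts)"
      proof (rule card_image_kernel_mono(2)[OF finite_pts, where y = "l e" and z = "r e"])
        show "face (insert e A) (l e) \<noteq> face (insert e A) (r e)"
          using sides_separated_after[OF A e True] face_eq[OF insert.prems] lr_pts[OF e(1)] by blast
        show "face A (l e) = face A (r e)"
          using sides_joined_before[OF A e] face_eq[OF A] lr_pts[OF e(1)] by blast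
      qed (fact fker lr_pts[OF e(1)])+
      then show ?thesis ..
    next
      case False
      have "card ((\<lambda>v. linked (insert e A) `` {v}) ` verts D) < card ((\<lambda>v. linked A `` {v}) ` verts D)"
      proof (rule card_image_kernel_mono(2)[OF finite_verts, where y = "tail D e" and z = "head D e"])
        show "linked A `` {tail D e} \<noteq> linked A `` {head D e}" using False unfolding linked_class_eq .
        show "linked (insert e A) `` {tail D e} = linked (insert e A) `` {head D e}"
          unfolding linked_class_eq by (rule linked_ends) simp
      qed (fact lker ends_in_verts[OF e(1)])+
      then show ?thesis ..
    qed
    then show ?case using insert.IH[OF A] insert.hyps f_le l_le by simp linarith
  qed
qed

end

context drawn_digraph
begin

text \<open>
  A walk from the head of \<open>e\<close> to its tail is back at the head of \<open>e\<close> after its last use of \<open>e\<close>.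
\<close>
lemma linked_avoiding_arc:
  assumes sc: "strongly_connected D" and e: "e \<in> arcs D"
  shows "(head D e, tail D e) \<in> linked (arcs D - {e})"
proof -
  interpret fin_digraph D by (rule fin)
  have "head D e \<rightarrow>\<^sup>*\<^bsub>D\<^esub> tail D e" using sc ends_in_verts e by (auto simp: strongly_connected_def)
  then have "(head D e, tail D e) \<in> (arcs_ends D)\<^sup>*" by (rule reachable_rtranclI)
  then have "(\<lambda>x. (x, tail D e) \<in> linked (arcs D - {e}) \<or> (head D e, tail D e) \<in> linked (arcs D - {e})) (head D e)"
  proof (induction rule: converse_rtrancl_induct)
    case base
    then show ?case using linked_refl by blast
  next
    case (step x y)
    then obtain a where a: "a \<in> arcs D" "x = tail D a" "y = head D a" by (auto simp: arcs_ends_conv)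
    show ?case
    proof (cases "a = e")
      case True
      then show ?thesis using step.IH a linked_refl by auto
    next
      case False
      then have "(x, y) \<in> linked (arcs D - {e})" using a linked_ends[of a "arcs D - {e}"] by auto
      then show ?thesis using step.IH linked_trans by blast
    qed
  qed
  then show ?thesis by blast
qed

lemma sided_drawing_exists:
  assumes sc: "strongly_connected D"
  obtains l r Q d where "sided_drawing D pos \<gamma> l r Q d"
proof -
  have "\<exists>l r q d. path q \<and> pathstart q = pos (head D e) \<and> pathfinish q = pos (tail D e) \<and>
      path_image q \<subseteq> drawn (arcs D - {e}) \<and> d > 0 \<and> ball (\<gamma> e (1/2)) d \<inter> drawn (arcs D - {e}) = {} \<and>
      ball (\<gamma> e (1/2)) d \<inter> outer_parts (\<gamma> e) (1/4) = {} \<and>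
      l \<in> ball (\<gamma> e (1/2)) d \<and> r \<in> ball (\<gamma> e (1/2)) d \<and> l \<notin> path_image (\<gamma> e) \<and> r \<notin> path_image (\<gamma> e) \<and>
      winding_number (\<gamma> e +++ q) l - winding_number (\<gamma> e +++ q) r = 1" if e: "e \<in> arcs D" for e
  proof -
    let ?A = "arcs D - {e}"
    obtain q where q: "arc q" "path_image q \<subseteq> drawn ?A" "pathstart q = pos (head D e)" "pathfinish q = pos (tail D e)"
      using linked_arc[OF linked_avoiding_arc[OF sc e]] tail_neq_head[OF e] ends_in_verts[OF e] by (metis Diff_subset)
    have inj: "inj_on (\<gamma> e) {0..1}" and cont: "continuous_on {0..1} (\<gamma> e)"
      using curve[OF e] by (auto simp: arc_def path_def)
    have ends: "\<gamma> e 0 = pos (tail D e)" "\<gamma> e 1 = pos (head D e)"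
      using curve[OF e] by (simp_all add: pathstart_def pathfinish_def)
    let ?x = "\<gamma> e (1/2)"
    have x: "?x \<in> path_image (\<gamma> e)" by (simp add: path_image_def)
    have xd: "?x \<noteq> \<gamma> e t" if "t \<in> {0..1}" "t \<noteq> 1/2" for t
      using inj_onD[OF inj, of "1/2" t] that by auto
    have meet: "drawn ?A \<inter> path_image (\<gamma> e) \<subseteq> {pos (tail D e), pos (head D e)}"
      using e by (intro curve_meets_drawn) auto
    then have "?x \<notin> drawn ?A" using x xd[of 0] xd[of 1] ends by auto
    moreover have "?x \<notin> outer_parts (\<gamma> e) (1/4)"
    proof
      assume "?x \<in> outer_parts (\<gamma> e) (1/4)"
      then obtain t where "?x = \<gamma> e t" "t \<in> {0..1}" "t \<noteq> 1/2" by (auto simp: outer_parts_def)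
      then show False using xd by blast
    qed
    ultimately have "?x \<in> - (drawn ?A \<union> outer_parts (\<gamma> e) (1/4))" by blast
    moreover have "open (- (drawn ?A \<union> outer_parts (\<gamma> e) (1/4)))"
      unfolding outer_parts_def
      by (intro open_Compl closed_Un compact_imp_closed compact_drawn compact_continuous_image continuous_on_subset[OF cont]) auto
    ultimately obtain d where d: "d > 0" "ball ?x d \<subseteq> - (drawn ?A \<union> outer_parts (\<gamma> e) (1/4))"
      by (meson open_contains_ball)
    have "path_image (\<gamma> e) \<inter> path_image q \<subseteq> {pathstart (\<gamma> e), pathfinish (\<gamma> e)}"
      using meet q(2) curve[OF e] by auto
    moreover have "pathstart q = pathfinish (\<gamma> e)" "pathfinish q = pathstart (\<gamma> e)"
      using q curve[OF e] by simp_all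
    ultimately obtain l r where lr: "l \<in> ball ?x d" "r \<in> ball ?x d" "l \<notin> path_image (\<gamma> e)" "r \<notin> path_image (\<gamma> e)"
      "winding_number (\<gamma> e +++ q) l - winding_number (\<gamma> e +++ q) r = 1"
      using sides_of_arc_on_closed_curve[OF curve(1)[OF e] q(1) _ _ _ d(1) x] by blast
    have "ball ?x d \<inter> drawn ?A = {}" "ball ?x d \<inter> outer_parts (\<gamma> e) (1/4) = {}" using d(2) by blast+
    then show ?thesis
      using q d(1) lr arc_imp_path[OF q(1)]
      by (intro exI[of _ l] exI[of _ r] exI[of _ q] exI[of _ d] conjI)
  qed
  then obtain l r Q d where *: "\<And>e. e \<in> arcs D \<Longrightarrow> path (Q e) \<and> pathstart (Q e) = pos (head D e) \<and> pathfinish (Q e) = pos (tail D e) \<and>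
      path_image (Q e) \<subseteq> drawn (arcs D - {e}) \<and> d e > 0 \<and> ball (\<gamma> e (1/2)) (d e) \<inter> drawn (arcs D - {e}) = {} \<and>
      ball (\<gamma> e (1/2)) (d e) \<inter> outer_parts (\<gamma> e) (1/4) = {} \<and>
      l e \<in> ball (\<gamma> e (1/2)) (d e) \<and> r e \<in> ball (\<gamma> e (1/2)) (d e) \<and> l e \<notin> path_image (\<gamma> e) \<and> r e \<notin> path_image (\<gamma> e) \<and>
      winding_number (\<gamma> e +++ Q e) (l e) - winding_number (\<gamma> e +++ Q e) (r e) = 1"
    by metis
  have "sided_drawing D pos \<gamma> l r Q d"
    by (intro sided_drawing.intro sided_drawing_axioms.intro drawn_digraph_axioms)
      (drule *, elim conjE, assumption)+
  then show thesis by (rule that)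
qed

end

section \<open>Shortcuts in the dual\<close>

text \<open>
  A multiset of pairs is a digraph on the faces; \<open>closed_under\<close> singles out the sets that no arc enters.
\<close>
definition imbalance :: "('f \<times> 'f) multiset \<Rightarrow> 'f \<Rightarrow> int" where
  "imbalance M x = int (count (image_mset fst M) x) - int (count (image_mset snd M) x)"

definition closed_under :: "('f \<times> 'f) multiset \<Rightarrow> 'f set \<Rightarrow> bool" where
  "closed_under M X \<longleftrightarrow> (\<forall>(p, q)\<in>#M. q \<in> X \<longrightarrow> p \<in> X)"

definition crosses :: "('f \<times> 'f) multiset \<Rightarrow> 'f set \<Rightarrow> bool" where
  "crosses M X \<longleftrightarrow> (\<exists>(p, q)\<in>#M. p \<in> X \<and> q \<notin> X)"

text \<open>
  A pair of consecutive arcs \<open>(p, q)\<close> and \<open>(q, r)\<close> is replaced by \<open>(p, r)\<close>, or deleted if \<open>p = r\<close>. A set that no arc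
  enters is left by one of the two old arcs if and only if it is left by the new one. When no consecutive arcs remain, every
  face has only outgoing or only incoming arcs, and the arcs are counted by the positive imbalances.
\<close>
lemma shortcut_multiset:
  assumes "finite S" "\<And>p q. (p, q) \<in># M \<Longrightarrow> p \<in> S \<and> q \<in> S \<and> p \<noteq> q"
  shows "\<exists>M'. set_mset M' \<subseteq> S \<times> S \<and> int (size M') = (\<Sum>x\<in>S. max (imbalance M x) 0) \<and>
    (\<forall>X. closed_under M X \<longrightarrow> closed_under M' X \<and> (crosses M' X \<longleftrightarrow> crosses M X))"
  using assms(2)
proof (induction "size M" arbitrary: M rule: less_induct)
  case less
  show ?case
  proof (cases "\<exists>p q r. (p, q) \<in># M \<and> (q, r) \<in># M")
    case True
    then obtain p q r where pqr: "(p, q) \<in># M" "(q, r) \<in># M" by blast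
    then have ne: "p \<noteq> q" "q \<noteq> r" "p \<in> S" "r \<in> S" using less.prems by blast+
    then have "(q, r) \<in># M - {#(p, q)#}" using pqr by (auto simp: in_diff_count)
    then obtain K where K: "M = add_mset (p, q) (add_mset (q, r) K)"
      using pqr(1) by (metis insert_DiffM)
    define N where "N = (if p = r then K else add_mset (p, r) K)"
    have sz: "size N < size M" by (simp add: N_def K)
    have N: "x \<in> S \<and> y \<in> S \<and> x \<noteq> y" if "(x, y) \<in># N" for x y
      using that ne less.prems[of x y] by (auto simp: N_def K split: if_splits)
    have imb: "imbalance N x = imbalance M x" for x
      by (auto simp: N_def K imbalance_def)
    obtain M' where M': "set_mset M' \<subseteq> S \<times> S" "int (size M') = (\<Sum>x\<in>S. max (imbalance N x) 0)"
        "\<And>X. closed_under N X \<Longrightarrow> closed_under M' X \<and> (crosses M' X \<longleftrightarrow> crosses N X)"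
      using less.hyps[OF sz N] by blast
    have "closed_under N X \<and> (crosses N X \<longleftrightarrow> crosses M X)" if "closed_under M X" for X
      using that by (auto simp: N_def K closed_under_def crosses_def)
    then show ?thesis using M' imb by (intro exI[of _ M']) auto
  next
    case False
    have "max (imbalance M x) 0 = int (count (image_mset fst M) x)" for x
    proof -
      have "count (image_mset fst M) x = 0 \<or> count (image_mset snd M) x = 0"
        using False by (force simp: count_eq_zero_iff)
      then show ?thesis unfolding imbalance_def by linarith
    qed
    moreover have "(\<Sum>x\<in>S. int (count (image_mset fst M) x)) = int (size M)"
    proof -
      have "set_mset (image_mset fst M) \<subseteq> S" using less.prems by auto
      then have "(\<Sum>x\<in>S. count (image_mset fst M) x) = size (image_mset fst M)"
        using assms(1) by (auto simp: size_multiset_overloaded_eq count_eq_zero_iff intro!: sum.mono_neutral_right)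
      then show ?thesis by (metis of_nat_sum size_image_mset)
    qed
    ultimately show ?thesis using less.prems by (intro exI[of _ M]) auto
  qed
qed

text \<open>
  The combinatorial content of a drawing of a strongly connected digraph. The condition \<open>boundary\<close> says that the
  boundary of a face is a circulation, and \<open>cycle_cut\<close> that every cycle contains all arcs of some directed cut of the dual.
\<close>
locale facial_digraph = digraph D for D :: "('a, 'b) pre_digraph" +
  fixes L R :: "'b \<Rightarrow> 'f"
  assumes sides_distinct: "a \<in> arcs D \<Longrightarrow> L a \<noteq> R a"
    and boundary: "(\<Sum>a\<in>arcs D. (of_bool (L a = \<phi>) - of_bool (R a = \<phi>)) *
      (of_bool (head D a = x) - of_bool (tail D a = x))) = (0::int)"
    and cycle_cut: "cycle p \<Longrightarrow> \<exists>X. (\<forall>a\<in>arcs D. R a \<in> X \<longrightarrow> L a \<in> X) \<and>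
      (\<forall>a\<in>arcs D. L a \<in> X \<and> R a \<notin> X \<longrightarrow> a \<in> set p) \<and> (\<exists>a\<in>arcs D. L a \<in> X \<and> R a \<notin> X)"
    and dual_connected: "\<lbrakk>X \<subseteq> L ` arcs D \<union> R ` arcs D; X \<noteq> {}; X \<noteq> L ` arcs D \<union> R ` arcs D\<rbrakk> \<Longrightarrow>
      \<exists>a\<in>arcs D. (L a \<in> X) \<noteq> (R a \<in> X)"
    and euler: "card (arcs D) + 2 \<le> card (verts D) + card (L ` arcs D \<union> R ` arcs D)"
begin

definition faces :: "'f set" where
  "faces = L ` arcs D \<union> R ` arcs D"

lemma finite_faces: "finite faces"
  by (simp add: faces_def)

lemma LR_faces: "a \<in> arcs D \<Longrightarrow> L a \<in> faces" "a \<in> arcs D \<Longrightarrow> R a \<in> faces"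
  by (auto simp: faces_def)

definition side :: "'f \<Rightarrow> 'b \<Rightarrow> int" where
  "side \<phi> a = of_bool (L a = \<phi>) - of_bool (R a = \<phi>)"

definition circulation :: "('b \<Rightarrow> int) \<Rightarrow> bool" where
  "circulation y \<longleftrightarrow> (\<forall>x. (\<Sum>a\<in>arcs D. y a * (of_bool (head D a = x) - of_bool (tail D a = x))) = 0)"

lemma side_circulation: "circulation (side \<phi>)"
  using boundary by (simp add: circulation_def side_def)

lemma circulation_in_out:
  assumes "circulation y"
  shows "(\<Sum>a\<in>in_arcs D x. y a) = (\<Sum>a\<in>out_arcs D x. y a)"
proof -
  have "(\<Sum>a\<in>in_arcs D x. y a) = (\<Sum>a\<in>arcs D. y a * of_bool (head D a = x))"
    by (intro sum.mono_neutral_cong_left) auto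
  moreover have "(\<Sum>a\<in>out_arcs D x. y a) = (\<Sum>a\<in>arcs D. y a * of_bool (tail D a = x))"
    by (intro sum.mono_neutral_cong_left) auto
  ultimately show ?thesis
    using assms by (simp add: circulation_def right_diff_distrib sum_subtractf)
qed

lemma cycle_in_closed_arc_set:
  assumes Y: "Y \<subseteq> arcs D" "Y \<noteq> {}" and step: "\<And>a. a \<in> Y \<Longrightarrow> \<exists>b\<in>Y. tail D b = head D a"
  obtains p where "cycle p" "set p \<subseteq> Y"
proof -
  define H where "H = \<lparr>verts = verts D, arcs = Y, tail = tail D, head = head D\<rparr>"
  interpret H: wf_digraph H using Y by unfold_locales (auto simp: H_def)
  have sub: "subgraph H D"
    using H.wf_digraph_axioms wf_digraph_axioms Y by (auto simp: subgraph_def H_def compatible_def)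
  have "\<not> acyclic (arcs_ends H)"
  proof
    assume ac: "acyclic (arcs_ends H)"
    have "finite (arcs_ends H)" using finite_subset[OF Y(1)] by (simp add: arcs_ends_def H_def)
    then have wf: "wf ((arcs_ends H)\<inverse>)" using ac by (rule finite_acyclic_wf_converse)
    obtain a where "a \<in> Y" using Y by blast
    then have "head D a \<in> head D ` Y" by blast
    then obtain z where z: "z \<in> head D ` Y" "\<And>y. (y, z) \<in> (arcs_ends H)\<inverse> \<Longrightarrow> y \<notin> head D ` Y"
      using wfE_min[OF wf] by metis
    then obtain b where "b \<in> Y" "tail D b = z" using step by blast
    then have "(z, head D b) \<in> arcs_ends H" by (auto simp: arcs_ends_conv H_def)
    then show False using z(2) \<open>b \<in> Y\<close> by blast
  qed
  then obtain x where "(x, x) \<in> (arcs_ends H)\<^sup>+" by (auto simp: acyclic_def)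
  then obtain w where "H.awalk x w x" "w \<noteq> []" using H.reachable1_awalk by blast
  then have "H.closed_w w" by (auto simp: H.closed_w_def)
  then obtain p where p: "H.cycle p" using H.closed_w_imp_cycle by blast
  then obtain u where "H.awalk u p u" by (auto simp only: H.cycle_def)
  then have "set p \<subseteq> Y" by (simp add: H.awalk_def) (simp add: H_def)
  then show thesis using that subgraph_cycle[OF sub p] by blast
qed

text \<open>
  By conservation an arc with positive value can be continued by another one, provided that no arc into the same vertex
  has a negative value that could absorb the flow.
\<close>
lemma circulation_cycle:
  assumes y: "circulation y" and a0: "a0 \<in> arcs D" "y a0 > 0"
    and same: "\<And>a b. \<lbrakk>a \<in> arcs D; b \<in> arcs D; head D a = head D b; y a > 0\<rbrakk> \<Longrightarrow> y b \<ge> 0"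
  obtains p where "cycle p" "set p \<subseteq> {a \<in> arcs D. y a > 0}"
proof (rule cycle_in_closed_arc_set[of "{a \<in> arcs D. y a > 0}"])
  fix a assume a: "a \<in> {a \<in> arcs D. y a > 0}"
  have "0 < (\<Sum>b\<in>in_arcs D (head D a). y b)"
    using a same by (intro sum_pos2[of _ a]) auto
  then have "0 < (\<Sum>b\<in>out_arcs D (head D a). y b)" using circulation_in_out[OF y] by simp
  then obtain b where "b \<in> out_arcs D (head D a)" "y b > 0"
    by (meson not_le sum_nonpos)
  then show "\<exists>b\<in>{a \<in> arcs D. y a > 0}. tail D b = head D a" by auto
qed (use a0 that in auto)

lemma cycle_length_le_heads:
  assumes "cycle p" "set p \<subseteq> Y" "finite Y"
  shows "length p \<le> card (head D ` Y)"
proof -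
  obtain u where u: "awalk u p u" "distinct (tl (awalk_verts u p))" "p \<noteq> []"
    using assms(1) by (auto simp: cycle_def)
  then have "cas u p u" by (auto simp: awalk_def)
  then have "distinct (map (head D) p)" using awalk_verts_conv'[of u p u] u by simp
  then have "length p = card (head D ` set p)" by (metis distinct_card length_map set_map)
  also have "\<dots> \<le> card (head D ` Y)" using assms by (intro card_mono) auto
  finally show ?thesis .
qed

definition dicut :: "'f set \<Rightarrow> bool" where
  "dicut X \<longleftrightarrow> X \<subseteq> faces \<and> X \<noteq> {} \<and> X \<noteq> faces \<and> (\<forall>a\<in>arcs D. R a \<in> X \<longrightarrow> L a \<in> X)"

text \<open>
  The indicator of the arcs leaving a directed cut is the sum of the boundaries of its faces, hence a
  nonnegative circulation. It contains a cycle, whose vertices are heads of its arcs.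
\<close>
lemma dicut_heads:
  assumes X: "dicut X" and g: "\<And>p. cycle p \<Longrightarrow> g \<le> length p"
  shows "g \<le> card (head D ` {a \<in> arcs D. L a \<in> X \<and> R a \<notin> X})"
proof -
  define y where "y a = (of_bool (L a \<in> X) - of_bool (R a \<in> X) :: int)" for a
  have fX: "finite X" using X finite_faces by (auto simp: dicut_def intro: finite_subset)
  have "y a = (\<Sum>\<phi>\<in>X. side \<phi> a)" for a
    using fX by (simp add: y_def side_def sum_subtractf of_bool_def)
  then have circ: "circulation y"
    unfolding circulation_def
    by (simp add: sum_distrib_right sum.swap[of _ X "arcs D"] side_circulation[unfolded circulation_def])
  have pos: "y a \<ge> 0" "y a > 0 \<longleftrightarrow> L a \<in> X \<and> R a \<notin> X" if "a \<in> arcs D" for a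
    using X that by (auto simp: y_def dicut_def)
  obtain a0 where a0: "a0 \<in> arcs D" "(L a0 \<in> X) \<noteq> (R a0 \<in> X)"
    using dual_connected[of X] X by (auto simp: dicut_def faces_def)
  then have "y a0 > 0" using X by (auto simp: y_def dicut_def)
  then obtain p where p: "cycle p" "set p \<subseteq> {a \<in> arcs D. y a > 0}"
    using circulation_cycle[OF circ a0(1)] pos(1) by blast
  have "{a \<in> arcs D. y a > 0} = {a \<in> arcs D. L a \<in> X \<and> R a \<notin> X}" using pos by auto
  then show ?thesis using cycle_length_le_heads[OF p] g[OF p(1)] by simp
qed

text \<open>
  The absolute value of \<open>in_side \<phi> v\<close> is the number of shortcuts of \<open>v\<close> that start or end in \<open>\<phi>\<close>; arcs into \<open>v\<close> with \<open>\<phi>\<close>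
  on opposite sides cancel.
\<close>
definition in_side :: "'f \<Rightarrow> 'a \<Rightarrow> int" where
  "in_side \<phi> v = (\<Sum>a\<in>in_arcs D v. side \<phi> a)"

lemma sum_in_arcs: "(\<Sum>v\<in>verts D. \<Sum>a\<in>in_arcs D v. (f a :: int)) = (\<Sum>a\<in>arcs D. f a)"
proof -
  have "(\<Sum>v\<in>verts D. \<Sum>a\<in>in_arcs D v. f a) = (\<Sum>v\<in>verts D. \<Sum>a\<in>{a \<in> arcs D. head D a = v}. f a)"
    by (simp add: in_arcs_def)
  also have "\<dots> = (\<Sum>a\<in>arcs D. f a)" by (rule sum.group) auto
  finally show ?thesis .
qed

lemma abs_side: "a \<in> arcs D \<Longrightarrow> \<bar>side \<phi> a\<bar> = of_bool (L a = \<phi> \<or> R a = \<phi>)"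
  using sides_distinct[of a] by (auto simp: side_def)

text \<open>
  Both ends of an arc on the boundary of \<open>\<phi>\<close> are incident with a further boundary arc. If these two coincided, they
  would be parallel or opposite to the given arc.
\<close>
lemma face_length_ge_3:
  assumes \<phi>: "\<phi> \<in> faces" and g: "\<And>p. cycle p \<Longrightarrow> 3 \<le> length p"
  shows "3 \<le> card {a \<in> arcs D. side \<phi> a \<noteq> 0}"
proof -
  let ?S = "{a \<in> arcs D. side \<phi> a \<noteq> 0}"
  obtain e where e: "e \<in> arcs D" "side \<phi> e \<noteq> 0"
    using \<phi> sides_distinct by (force simp: faces_def side_def)
  have other: "\<exists>e'\<in>?S. e' \<noteq> e \<and> (head D e' = x \<or> tail D e' = x)" if x: "head D e = x \<or> tail D e = x" for x
  proof (rule ccontr)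
    assume no: "\<not> ?thesis"
    have "(\<Sum>a\<in>arcs D. side \<phi> a * (of_bool (head D a = x) - of_bool (tail D a = x)))
        = (\<Sum>a\<in>{e}. side \<phi> a * (of_bool (head D a = x) - of_bool (tail D a = x)))"
      using e no by (intro sum.mono_neutral_right) auto
    then show False
      using side_circulation[of \<phi>] e x no_loops[OF e(1)] by (auto simp: circulation_def)
  qed
  obtain e2 where e2: "e2 \<in> ?S" "e2 \<noteq> e" "head D e2 = head D e \<or> tail D e2 = head D e"
    using other[of "head D e"] by blast
  obtain e3 where e3: "e3 \<in> ?S" "e3 \<noteq> e" "head D e3 = tail D e \<or> tail D e3 = tail D e"
    using other[of "tail D e"] by blast
  have "e2 \<noteq> e3"
  proof
    assume "e2 = e3"
    then consider "head D e2 = head D e" "tail D e2 = tail D e" | "tail D e2 = head D e" "head D e2 = tail D e"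
      using e2 e3 no_loops[OF e(1)] by metis
    then show False
    proof cases
      case 1
      then show ?thesis using no_multi_arcs[of e2 e] e2 e by (simp add: arc_to_ends_def)
    next
      case 2
      have "cycle [e, e2]"
        unfolding cycle_def using e e2 2 no_loops[OF e(1)]
        by (intro exI[of _ "tail D e"]) (auto simp: awalk_def)
      then show ?thesis using g by fastforce
    qed
  qed
  then have "card {e, e2, e3} = 3" using e2 e3 by auto
  moreover have "{e, e2, e3} \<subseteq> ?S" using e e2 e3 by auto
  moreover have "finite ?S" by simp
  ultimately show ?thesis using card_mono by metis
qed

text \<open>
  If \<open>t\<close> and \<open>l\<close> denote the two sums, then \<open>l - t\<close> is a sum of even nonnegative gaps, one for each vertex. For \<open>t = l\<close> all gaps
  vanish, so at each vertex the incoming boundary arcs have \<open>\<phi>\<close> on the same side. This makes the boundary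
  contain a directed cycle, and \<open>l \<ge> g\<close> suffices. Otherwise \<open>t \<le> l - 2\<close>, and \<open>l \<ge> 3\<close> suffices.
\<close>
lemma face_inequality:
  assumes \<phi>: "\<phi> \<in> faces" and g: "\<And>p. cycle p \<Longrightarrow> g \<le> length p" "3 \<le> g"
  shows "(int g - 3) * (\<Sum>v\<in>verts D. \<bar>in_side \<phi> v\<bar>)
    \<le> (int g - 1) * (\<Sum>a\<in>arcs D. \<bar>side \<phi> a\<bar>) - 2 * int g"
proof -
  define l where "l = (\<Sum>a\<in>arcs D. \<bar>side \<phi> a\<bar>)"
  define t where "t = (\<Sum>v\<in>verts D. \<bar>in_side \<phi> v\<bar>)"
  define gap where "gap v = (\<Sum>a\<in>in_arcs D v. \<bar>side \<phi> a\<bar>) - \<bar>in_side \<phi> v\<bar>" for v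
  have gap0: "gap v \<ge> 0" for v by (simp add: gap_def in_side_def sum_abs)
  have gap2: "even (gap v)" for v
  proof -
    have "even (\<Sum>a\<in>in_arcs D v. \<bar>side \<phi> a\<bar> + side \<phi> a)"
      by (intro dvd_sum) (auto simp: abs_if)
    then show ?thesis by (auto simp: gap_def in_side_def sum.distrib abs_if)
  qed
  have lt: "l - t = (\<Sum>v\<in>verts D. gap v)"
    unfolding l_def t_def gap_def by (simp add: sum_subtractf sum_in_arcs)
  have lc: "l = int (card {a \<in> arcs D. side \<phi> a \<noteq> 0})"
  proof -
    have "l = (\<Sum>a\<in>arcs D. of_bool (side \<phi> a \<noteq> 0))"
      unfolding l_def by (intro sum.cong refl) (auto simp: side_def)
    then show ?thesis by (simp add: sum_of_bool_eq Int_def)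
  qed
  have l3: "3 \<le> l" 
  proof -
    have "3 \<le> length p" if "cycle p" for p using g(1)[OF that] g(2) by linarith
    then show ?thesis using face_length_ge_3[OF \<phi>] lc by simp
  qed
  show ?thesis
  proof (cases "t = l")
    case True
    then have gz: "gap v = 0" if "v \<in> verts D" for v
      using lt gap0 sum_nonneg_eq_0_iff[of "verts D" gap] that by simp
    have same: "s * side \<phi> b \<ge> 0"
      if s: "s = 1 \<or> s = -1" and ab: "a \<in> arcs D" "b \<in> arcs D" "head D a = head D b" "s * side \<phi> a > 0" for s a b
    proof (rule ccontr)
      assume "\<not> ?thesis"
      then have neg: "s * side \<phi> b < 0" by simp
      let ?I = "in_arcs D (head D b)"
      have "\<bar>in_side \<phi> (head D b)\<bar> < (\<Sum>a\<in>?I. \<bar>side \<phi> a\<bar>)"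
      proof -
        have "\<bar>in_side \<phi> (head D b)\<bar> = \<bar>s * in_side \<phi> (head D b)\<bar>" using s by (auto simp: abs_mult)
        also have "s * in_side \<phi> (head D b) = (\<Sum>a\<in>?I. s * side \<phi> a)" by (simp add: in_side_def sum_distrib_left)
        also have "\<bar>\<dots>\<bar> < (\<Sum>a\<in>?I. \<bar>s * side \<phi> a\<bar>)"
        proof -
          have "(\<Sum>a\<in>?I. s * side \<phi> a) < (\<Sum>a\<in>?I. \<bar>s * side \<phi> a\<bar>)"
            using neg ab by (intro sum_strict_mono_ex1) (auto intro!: bexI[of _ b])
          moreover have "(\<Sum>a\<in>?I. - (s * side \<phi> a)) < (\<Sum>a\<in>?I. \<bar>s * side \<phi> a\<bar>)"
            using ab by (intro sum_strict_mono_ex1) (auto intro!: bexI[of _ a])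
          ultimately show ?thesis by (simp add: sum_negf abs_if)
        qed
        also have "\<dots> = (\<Sum>a\<in>?I. \<bar>side \<phi> a\<bar>)" using s by (auto simp: abs_mult)
        finally show ?thesis .
      qed
      then show False using gz[of "head D b"] ab by (simp add: gap_def)
    qed
    have "{a \<in> arcs D. side \<phi> a \<noteq> 0} \<noteq> {}" using l3 lc by (intro notI) simp
    then obtain e where e: "e \<in> arcs D" "side \<phi> e \<noteq> 0" by blast
    (* All arcs with this sign have \<phi> on the same side as e. *)
    define s where "s = sgn (side \<phi> e)"
    have s: "s = 1 \<or> s = -1" "s * side \<phi> e > 0" using e by (auto simp: s_def sgn_if)
    have "circulation (\<lambda>a. s * side \<phi> a)"
      using side_circulation[of \<phi>] by (simp add: circulation_def mult.assoc sum_distrib_left[symmetric])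
    then obtain p where p: "cycle p" "set p \<subseteq> {a \<in> arcs D. s * side \<phi> a > 0}"
      using circulation_cycle[of "\<lambda>a. s * side \<phi> a" e] e s same[OF s(1)] by blast
    have "{a \<in> arcs D. s * side \<phi> a > 0} \<subseteq> {a \<in> arcs D. side \<phi> a \<noteq> 0}" by auto
    then have "length p \<le> card (head D ` {a \<in> arcs D. side \<phi> a \<noteq> 0})"
      using p by (intro cycle_length_le_heads) auto
    also have "\<dots> \<le> card {a \<in> arcs D. side \<phi> a \<noteq> 0}" by (intro card_image_le) auto
    finally have "int g \<le> l" using g(1)[OF p(1)] lc by simp
    then show ?thesis using True unfolding l_def[symmetric] t_def[symmetric] by (simp add: algebra_simps)
  next
    case False
    have "even (l - t)" unfolding lt using gap2 by (intro dvd_sum) auto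
    moreover have "t \<le> l" using lt gap0 sum_nonneg[of "verts D" gap] by simp
    ultimately have "t \<le> l - 2" using False by presburger
    then have "(int g - 3) * t \<le> (int g - 3) * (l - 2)" using g(2) by (intro mult_left_mono) auto
    also have "\<dots> \<le> (int g - 1) * l - 2 * int g" using l3 by (simp add: algebra_simps)
    finally show ?thesis unfolding l_def t_def .
  qed
qed

definition dual_in :: "'a \<Rightarrow> ('f \<times> 'f) multiset" where
  "dual_in v = image_mset (\<lambda>a. (L a, R a)) (mset_set (in_arcs D v))"

lemma imbalance_dual_in: "imbalance (dual_in v) \<phi> = in_side \<phi> v"
proof -
  have c: "int (count (image_mset f (mset_set A)) \<phi>) = (\<Sum>a\<in>A. of_bool (f a = \<phi>))" if "finite A" for f :: "'b \<Rightarrow> 'f" and A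
    using that by (induction A rule: finite_induct) auto
  have "imbalance (dual_in v) \<phi> = int (count (image_mset L (mset_set (in_arcs D v))) \<phi>) - int (count (image_mset R (mset_set (in_arcs D v))) \<phi>)"
    by (simp add: imbalance_def dual_in_def image_mset.compositionality comp_def)
  then show ?thesis by (simp add: c finite_in_arcs in_side_def side_def sum_subtractf)
qed

lemma set_dual_in: "set_mset (dual_in v) = (\<lambda>a. (L a, R a)) ` in_arcs D v"
  by (simp add: dual_in_def finite_in_arcs)

section \<open>The bound\<close>

text \<open>
  The Lucchesi--Younger theorem is applied to the shortcuts of all vertices, each of capacity one, with the
  directed cuts of the dual as crossing family. A directed cut met by a shortcut of \<open>v\<close> is left by an arc into \<open>v\<close>;
  for the cut obtained from a cycle, this arc lies on the cycle.
\<close>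
theorem feedback_bound:
  assumes g: "\<And>p. cycle p \<Longrightarrow> g \<le> length p" "4 \<le> g"
  shows "int (fv D) * int g * (int g - 3) \<le> int g * (int (card (verts D)) - 2) - int (card (arcs D))"
proof -
  have "\<exists>bs. set bs \<subseteq> faces \<times> faces \<and> int (length bs) = (\<Sum>\<phi>\<in>faces. max (in_side \<phi> v) 0) \<and>
    (\<forall>X. closed_under (dual_in v) X \<longrightarrow> closed_under (mset bs) X \<and> (crosses (mset bs) X \<longleftrightarrow> crosses (dual_in v) X))" for v
  proof -
    have "\<exists>M'. set_mset M' \<subseteq> faces \<times> faces \<and> int (size M') = (\<Sum>x\<in>faces. max (imbalance (dual_in v) x) 0) \<and>
      (\<forall>X. closed_under (dual_in v) X \<longrightarrow> closed_under M' X \<and> (crosses M' X \<longleftrightarrow> crosses (dual_in v) X))"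
      by (rule shortcut_multiset[OF finite_faces]) (use sides_distinct LR_faces in \<open>auto simp: set_dual_in\<close>)
    then obtain M' where M': "set_mset M' \<subseteq> faces \<times> faces" "int (size M') = (\<Sum>x\<in>faces. max (imbalance (dual_in v) x) 0)"
      "\<forall>X. closed_under (dual_in v) X \<longrightarrow> closed_under M' X \<and> (crosses M' X \<longleftrightarrow> crosses (dual_in v) X)" by blast
    obtain bs where "mset bs = M'" using ex_mset by blast
    then show ?thesis using M' by (intro exI[of _ bs]) (auto simp: imbalance_dual_in)
  qed
  then obtain bs where bs: "\<And>v. set (bs v) \<subseteq> faces \<times> faces"
      "\<And>v. int (length (bs v)) = (\<Sum>\<phi>\<in>faces. max (in_side \<phi> v) 0)"
      "\<And>v X. closed_under (dual_in v) X \<Longrightarrow> closed_under (mset (bs v)) X"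
      "\<And>v X. closed_under (dual_in v) X \<Longrightarrow> crosses (mset (bs v)) X \<longleftrightarrow> crosses (dual_in v) X"
    by metis
  define B where "B = (SIGMA v:verts D. {..<length (bs v)})"
  define src where "src b = fst (bs (fst b) ! snd b)" for b :: "'a \<times> nat"
  define dst where "dst b = snd (bs (fst b) ! snd b)" for b :: "'a \<times> nat"
  have bmem: "(src b, dst b) \<in> set (bs (fst b))" if "b \<in> B" for b
    using that by (auto simp: B_def src_def dst_def)
  have closed: "closed_under (dual_in v) X" if "dicut X" for v X
    using that by (auto simp: closed_under_def set_dual_in dicut_def)
  interpret C: crossing_family faces "{X. dicut X}" B src dst
  proof unfold_locales
    show "finite faces" by (rule finite_faces)
    show "finite B" by (auto simp: B_def)
    fix X Y assume XY: "X \<in> {X. dicut X}" "Y \<in> {X. dicut X}" "X \<inter> Y \<noteq> {}" "X \<union> Y \<noteq> faces"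
    then show "X \<inter> Y \<in> {X. dicut X} \<and> X \<union> Y \<in> {X. dicut X}"
      by (auto simp: dicut_def)
  next
    fix b assume "b \<in> B"
    then show "src b \<in> faces" "dst b \<in> faces" using bmem bs(1) by blast+
  next
    fix X b assume "X \<in> {X. dicut X}" "b \<in> B" "dst b \<in> X"
    then show "src b \<in> X" using bs(3)[OF closed, of X "fst b"] bmem[of b] by (fastforce simp: closed_under_def)
  qed (auto simp: dicut_def)
  have cross_iff: "(\<exists>b\<in>B. fst b = v \<and> C.leaves b X) \<longleftrightarrow> (\<exists>a\<in>arcs D. head D a = v \<and> L a \<in> X \<and> R a \<notin> X)"
    if "dicut X" "v \<in> verts D" for X v
  proof -
    have "(\<exists>b\<in>B. fst b = v \<and> C.leaves b X) \<longleftrightarrow> crosses (mset (bs v)) X"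
    proof
      assume "\<exists>b\<in>B. fst b = v \<and> C.leaves b X"
      then show "crosses (mset (bs v)) X" using bmem by (fastforce simp: crosses_def C.leaves_def)
    next
      assume "crosses (mset (bs v)) X"
      then obtain p q where pq: "(p, q) \<in> set (bs v)" "p \<in> X" "q \<notin> X" by (auto simp: crosses_def)
      then obtain i where "i < length (bs v)" "bs v ! i = (p, q)" by (metis in_set_conv_nth)
      then show "\<exists>b\<in>B. fst b = v \<and> C.leaves b X"
        using pq that by (intro bexI[of _ "(v, i)"]) (auto simp: B_def C.leaves_def src_def dst_def)
    qed
    also have "\<dots> \<longleftrightarrow> crosses (dual_in v) X" using bs(4)[OF closed[OF that(1)]] .
    also have "\<dots> \<longleftrightarrow> (\<exists>a\<in>arcs D. head D a = v \<and> L a \<in> X \<and> R a \<notin> X)"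
      by (auto simp: crosses_def set_dual_in)
    finally show ?thesis .
  qed
  have dicut_B: "g \<le> card {b \<in> B. C.leaves b X}" if X: "dicut X" for X
  proof -
    have "head D ` {a \<in> arcs D. L a \<in> X \<and> R a \<notin> X} \<subseteq> fst ` {b \<in> B. C.leaves b X}"
    proof
      fix v assume v: "v \<in> head D ` {a \<in> arcs D. L a \<in> X \<and> R a \<notin> X}"
      then have "\<exists>b\<in>B. fst b = v \<and> C.leaves b X"
        by (subst cross_iff[OF X]) auto
      then show "v \<in> fst ` {b \<in> B. C.leaves b X}" by blast
    qed
    then have "card (head D ` {a \<in> arcs D. L a \<in> X \<and> R a \<notin> X}) \<le> card (fst ` {b \<in> B. C.leaves b X})"
      using C.finite_B by (intro card_mono) auto
    also have "\<dots> \<le> card {b \<in> B. C.leaves b X}" using C.finite_B by (intro card_image_le) auto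
    finally show ?thesis using dicut_heads[OF X g(1)] by linarith
  qed
  define k where "k = card B div g"
  have "\<not> C.feasible (\<lambda>_. 1) (k + 1)"
  proof
    assume "C.feasible (\<lambda>_. 1) (k + 1)"
    then obtain X where X: "C.packing (\<lambda>_. 1) (k + 1) X" by (auto simp: C.feasible_def)
    have "(k + 1) * g = (\<Sum>i<k+1. g)" by simp
    also have "\<dots> \<le> (\<Sum>i<k+1. card {b \<in> B. C.leaves b (X i)})"
      using X dicut_B by (intro sum_mono) (auto simp: C.packing_def)
    also have "\<dots> = (\<Sum>i<k+1. \<Sum>b\<in>B. of_bool (C.leaves b (X i)))"
      using C.finite_B by (simp add: sum_of_bool_eq Int_def)
    also have "\<dots> = (\<Sum>b\<in>B. \<Sum>i<k+1. of_bool (C.leaves b (X i)))" by (rule sum.swap)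
    also have "\<dots> = (\<Sum>b\<in>B. card {i. i < k + 1 \<and> C.leaves b (X i)})"
      by (intro sum.cong refl) (simp add: sum_of_bool_eq Int_def del: sum.lessThan_Suc)
    also have "\<dots> \<le> (\<Sum>b\<in>B. 1)" using X by (intro sum_mono) (auto simp: C.packing_def)
    finally have "(k + 1) * g \<le> card B" by simp
    moreover have "card B < (k + 1) * g"
      using g(2) div_mult_mod_eq[of "card B" g] mod_less_divisor[of g "card B"]
      unfolding k_def add_mult_distrib by linarith
    ultimately show False by simp
  qed
  then obtain J where J: "J \<subseteq> B" "card J \<le> k" "\<And>X. dicut X \<Longrightarrow> \<exists>b\<in>J. C.leaves b X"
    using C.lucchesi_younger[of "\<lambda>_. 1" k] by auto
  have "feedback_vertex_set D (fst ` J)"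
    unfolding feedback_vertex_set_def
  proof (intro conjI notI)
    show "fst ` J \<subseteq> verts D" using J(1) by (auto simp: B_def)
    assume "\<exists>p. pre_digraph.cycle (D \<restriction> (verts D - fst ` J)) p"
    then obtain p where p: "pre_digraph.cycle (D \<restriction> (verts D - fst ` J)) p" by blast
    have "subgraph (D \<restriction> (verts D - fst ` J)) D"
      by (intro induced_imp_subgraph induced_induce) auto
    then have cp: "cycle p" using p by (rule subgraph_cycle)
    have avoid: "head D a \<notin> fst ` J" if "a \<in> set p" for a
      using p that by (auto simp: pre_digraph.cycle_def pre_digraph.awalk_def)
    obtain X0 where X0: "\<And>a. a \<in> arcs D \<Longrightarrow> R a \<in> X0 \<Longrightarrow> L a \<in> X0"
      "\<And>a. a \<in> arcs D \<Longrightarrow> L a \<in> X0 \<Longrightarrow> R a \<notin> X0 \<Longrightarrow> a \<in> set p" "\<exists>a\<in>arcs D. L a \<in> X0 \<and> R a \<notin> X0"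
      using cycle_cut[OF cp] by blast
    (* Only faces incident with arcs belong to the ground set of the crossing family. *)
  define X where "X = X0 \<inter> faces"
    have "dicut X" using X0(1,3) LR_faces by (auto simp: dicut_def X_def)
    then obtain b where b: "b \<in> J" "C.leaves b X" using J(3) by blast
    then have "\<exists>b'\<in>B. fst b' = fst b \<and> C.leaves b' X" using J(1) by blast
    moreover have "fst b \<in> verts D" using b J(1) by (auto simp: B_def)
    ultimately obtain a where a: "a \<in> arcs D" "head D a = fst b" "L a \<in> X" "R a \<notin> X"
      using cross_iff[OF \<open>dicut X\<close>] by blast
    then have "a \<in> set p" using X0(2) LR_faces by (auto simp: X_def)
    then show False using avoid a(2) b(1) by blast
  qed
  moreover have "finite {S. feedback_vertex_set D S}"
    by (rule finite_subset[of _ "Pow (verts D)"]) (auto simp: feedback_vertex_set_def)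
  ultimately have "fv D \<le> card (fst ` J)"
    unfolding fv_def by (intro Min_le) auto
  also have "\<dots> \<le> card J" using finite_subset[OF J(1) C.finite_B] by (rule card_image_le)
  also have "\<dots> \<le> k" by (rule J(2))
  finally have "fv D * g \<le> k * g" by simp
  also have "\<dots> \<le> card B" by (simp add: k_def)
  finally have fvB: "int (fv D) * int g \<le> int (card B)" by (metis of_nat_le_iff of_nat_mult)
  have "2 * int (card B) = (\<Sum>\<phi>\<in>faces. \<Sum>v\<in>verts D. \<bar>in_side \<phi> v\<bar>)"
  proof -
    have zero: "(\<Sum>\<phi>\<in>faces. in_side \<phi> v) = 0" for v
    proof -
      have "(\<Sum>\<phi>\<in>faces. side \<phi> a) = 0" if "a \<in> arcs D" for a
        using LR_faces[OF that] finite_faces by (simp add: side_def sum_subtractf of_bool_def)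
      then show ?thesis unfolding in_side_def by (subst sum.swap) simp
    qed
    have "2 * int (card B) = (\<Sum>v\<in>verts D. \<Sum>\<phi>\<in>faces. 2 * max (in_side \<phi> v) 0)"
      by (simp add: B_def bs(2) sum_distrib_left)
    also have "\<dots> = (\<Sum>v\<in>verts D. \<Sum>\<phi>\<in>faces. \<bar>in_side \<phi> v\<bar> + in_side \<phi> v)"
      by (intro sum.cong refl) (auto simp: max_def)
    also have "\<dots> = (\<Sum>v\<in>verts D. \<Sum>\<phi>\<in>faces. \<bar>in_side \<phi> v\<bar>)" by (simp add: sum.distrib zero)
    also have "\<dots> = (\<Sum>\<phi>\<in>faces. \<Sum>v\<in>verts D. \<bar>in_side \<phi> v\<bar>)" by (rule sum.swap)
    finally show ?thesis .
  qed
  then have "(int g - 3) * (2 * int (card B)) = (\<Sum>\<phi>\<in>faces. (int g - 3) * (\<Sum>v\<in>verts D. \<bar>in_side \<phi> v\<bar>))"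
    by (simp add: sum_distrib_left)
  also have "\<dots> \<le> (\<Sum>\<phi>\<in>faces. (int g - 1) * (\<Sum>a\<in>arcs D. \<bar>side \<phi> a\<bar>) - 2 * int g)"
    using g by (intro sum_mono face_inequality) auto
  also have "\<dots> = (int g - 1) * (\<Sum>\<phi>\<in>faces. \<Sum>a\<in>arcs D. \<bar>side \<phi> a\<bar>) - 2 * int g * int (card faces)"
    by (simp add: sum_subtractf sum_distrib_left)
  also have "(\<Sum>\<phi>\<in>faces. \<Sum>a\<in>arcs D. \<bar>side \<phi> a\<bar>) = 2 * int (card (arcs D))"
  proof -
    have "(\<Sum>\<phi>\<in>faces. \<bar>side \<phi> a\<bar>) = 2" if a: "a \<in> arcs D" for a
    proof -
      have "(\<Sum>\<phi>\<in>faces. \<bar>side \<phi> a\<bar>) = (\<Sum>\<phi>\<in>faces. of_bool (L a = \<phi>) + of_bool (R a = \<phi>))"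
        using sides_distinct[OF a] by (intro sum.cong refl) (auto simp: abs_side[OF a])
      then show ?thesis using LR_faces[OF a] finite_faces by (simp add: sum.distrib of_bool_def)
    qed
    then show ?thesis by (subst sum.swap) simp
  qed
  finally have "(int g - 3) * int (card B) \<le> (int g - 1) * int (card (arcs D)) - int g * int (card faces)"
    by (simp add: algebra_simps)
  moreover have "int g * (int (card (arcs D)) + 2 - int (card (verts D))) \<le> int g * int (card faces)"
    using euler by (intro mult_left_mono) (auto simp: faces_def)
  moreover have "int (fv D) * int g * (int g - 3) \<le> int (card B) * (int g - 3)"
    using fvB g(2) by (intro mult_right_mono) auto
  ultimately show ?thesis by (simp add: algebra_simps)
qed

end

section \<open>The facial structure of a plane drawing\<close>

context sided_drawing
begin

definition left_face :: "'b \<Rightarrow> complex set" where "left_face a = face (arcs D) (l a)"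
definition right_face :: "'b \<Rightarrow> complex set" where "right_face a = face (arcs D) (r a)"

lemma faces_of_sides: "left_face ` arcs D \<union> right_face ` arcs D = face (arcs D) ` pts"
  by (auto simp: left_face_def right_face_def pts_def)

lemma face_constI: "face_const (\<lambda>z. h (face (arcs D) z)) (arcs D)"
  unfolding face_const_def using face_eq[OF order_refl] by metis

lemma left_face_neq_right_face:
  assumes sc: "strongly_connected D" and a: "a \<in> arcs D"
  shows "left_face a \<noteq> right_face a"
proof -
  have "\<not> joined_off (drawn (insert a (arcs D - {a}))) (l a) (r a)"
    using linked_sym[OF linked_avoiding_arc[OF sc a]] a by (intro sides_separated_after) auto
  moreover have "insert a (arcs D - {a}) = arcs D" using a by blast
  ultimately show ?thesis
    using face_eq[OF order_refl lr_pts(1)[OF a] lr_pts(2)[OF a]] by (simp add: left_face_def right_face_def)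
qed

lemma face_boundary_circulation:
  "(\<Sum>a\<in>arcs D. (of_bool (left_face a = \<phi>) - of_bool (right_face a = \<phi>)) *
      (of_bool (head D a = x) - of_bool (tail D a = x))) = (0::int)" (is "?s = 0")
proof -
  have "(\<Sum>a\<in>arcs D. (of_bool (left_face a = \<phi>) - of_bool (right_face a = \<phi>)) * inc x a) = 0"
    using face_jumps_circulation[OF order_refl face_constI[of "\<lambda>f. of_bool (f = \<phi>)"], of x]
    by (simp only: left_face_def right_face_def)
  then have "of_int ?s = (0 :: complex)" by (simp add: inc_def)
  then show ?thesis by (simp only: of_int_eq_0_iff)
qed

lemma cycle_uwalk:
  assumes "pre_digraph.cas D v p w" "uwalk (arcs D) u f v" "set p \<subseteq> arcs D"
  shows "uwalk (arcs D) u (\<lambda>a. f a + of_nat (count_list p a)) w"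
  using assms
proof (induction p arbitrary: f v)
  case Nil
  then show ?case by (simp add: pre_digraph.cas.simps)
next
  case (Cons a p)
  then have a: "tail D a = v" "pre_digraph.cas D (head D a) p w" "a \<in> arcs D" "set p \<subseteq> arcs D"
    by (simp_all add: pre_digraph.cas.simps)
  have "uwalk (arcs D) u (f(a := f a + 1)) (head D a)"
    using Cons.prems(2) a by (intro uwalk.fwd) auto
  from Cons.IH[OF a(2) this a(4)]
  have "uwalk (arcs D) u (\<lambda>b. (f(a := f a + 1)) b + of_nat (count_list p b)) w" .
  moreover have "(\<lambda>b. (f(a := f a + 1)) b + of_nat (count_list p b)) = (\<lambda>b. f b + of_nat (count_list (a # p) b))"
    by (auto simp: fun_eq_iff)
  ultimately show ?case by simp
qed

text \<open>
  The winding number of the cycle rises by one from the right to the left of each of its arcs and is the same on both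
  sides of any other arc, so the set of faces where it exceeds its value at the right of one arc of the cycle is a directed cut.
\<close>
lemma face_cut_of_cycle:
  assumes p: "pre_digraph.cycle D p"
  shows "\<exists>X. (\<forall>a\<in>arcs D. right_face a \<in> X \<longrightarrow> left_face a \<in> X) \<and>
      (\<forall>a\<in>arcs D. left_face a \<in> X \<and> right_face a \<notin> X \<longrightarrow> a \<in> set p) \<and>
      (\<exists>a\<in>arcs D. left_face a \<in> X \<and> right_face a \<notin> X)"
proof -
  interpret fin_digraph D by (rule fin)
  obtain u where u: "awalk u p u" "distinct p" "p \<noteq> []"
    using p unfolding cycle_conv by blast
  define f :: "'b \<Rightarrow> complex" where "f a = of_bool (a \<in> set p)" for a
  have "uwalk (arcs D) u (\<lambda>a. 0 + of_nat (count_list p a)) u"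
    using u by (intro cycle_uwalk[OF _ uwalk.nil]) (auto simp: awalk_def)
  moreover have "(\<lambda>a. 0 + of_nat (count_list p a)) = f"
  proof
    fix a
    have "count_list p a = of_bool (a \<in> set p)" using u(2) by (induction p) auto
    then show "0 + of_nat (count_list p a) = f a" by (simp add: f_def)
  qed
  ultimately have W: "uwalk (arcs D) u f u" by simp
  define w where "w z = Re (wind \<gamma> f z)" for z
  have jump: "w (l a) = w (r a) + of_bool (a \<in> set p)" if "a \<in> arcs D" for a
    using arg_cong[OF wind_jump[OF W order_refl that], of Re] by (cases "a \<in> set p") (simp_all add: w_def f_def)
  obtain a0 where a0: "a0 \<in> set p" "a0 \<in> arcs D" using u by (cases p) (auto simp: awalk_def)
  define X where "X = face (arcs D) ` {z \<in> pts. w (r a0) < w z}"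
  have X: "face (arcs D) y \<in> X \<longleftrightarrow> w (r a0) < w y" if y: "y \<in> pts" for y
  proof -
    have "w z = w y" if "z \<in> pts" "face (arcs D) y = face (arcs D) z" for z
      using wind_locally_constant[OF W order_refl] face_eq[OF order_refl y that(1)] that(2) by (simp add: w_def)
    moreover have "face (arcs D) y \<in> X \<longleftrightarrow> (\<exists>z\<in>pts. face (arcs D) y = face (arcs D) z \<and> w (r a0) < w z)"
      by (auto simp: X_def)
    ultimately show ?thesis using y by metis
  qed
  have XL: "left_face a \<in> X \<longleftrightarrow> w (r a0) < w (l a)" "right_face a \<in> X \<longleftrightarrow> w (r a0) < w (r a)"
    if "a \<in> arcs D" for a
    using X lr_pts[OF that] by (auto simp: left_face_def right_face_def)
  have "right_face a \<in> X \<longrightarrow> left_face a \<in> X" "left_face a \<in> X \<and> right_face a \<notin> X \<longrightarrow> a \<in> set p"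
    if "a \<in> arcs D" for a
    using XL[OF that] jump[OF that] by (auto simp: of_bool_def split: if_splits)
  moreover have "left_face a0 \<in> X \<and> right_face a0 \<notin> X"
    using XL[OF a0(2)] jump[OF a0(2)] a0(1) by simp
  ultimately show ?thesis using a0(2) by (intro exI[of _ X]) blast
qed

lemma faces_adjacent:
  assumes X: "X \<subseteq> left_face ` arcs D \<union> right_face ` arcs D" "X \<noteq> {}" "X \<noteq> left_face ` arcs D \<union> right_face ` arcs D"
  shows "\<exists>a\<in>arcs D. (left_face a \<in> X) \<noteq> (right_face a \<in> X)"
proof (rule ccontr)
  assume "\<not> ?thesis"
  then have eq: "(face (arcs D) (l a) \<in> X) = (face (arcs D) (r a) \<in> X)" if "a \<in> arcs D" for a
    using that by (simp add: left_face_def right_face_def)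
  have const: "(face (arcs D) y \<in> X) = (face (arcs D) z \<in> X)" if "y \<in> pts" "z \<in> pts" for y z
    by (rule jumpless_imp_const[OF order_refl face_constI[of "\<lambda>f. f \<in> X"]]) (use eq that in auto)
  show False using X const unfolding faces_of_sides by blast
qed

lemma euler_inequality:
  assumes "arcs D \<noteq> {}"
  shows "card (arcs D) + 2 \<le> card (verts D) + card (left_face ` arcs D \<union> right_face ` arcs D)"
proof -
  have "verts D \<noteq> {}" using assms ends_in_verts by blast
  then have "0 < card ((\<lambda>v. linked (arcs D) `` {v}) ` verts D)"
    using finite_verts by (simp add: card_gt_0_iff)
  then show ?thesis using face_count[OF order_refl assms] unfolding faces_of_sides by linarith
qed

end

theorem planar_facial_digraph:
  assumes D: "digraph D" and pl: "plane_drawing D pos \<gamma>" and sc: "strongly_connected D" and ne: "arcs D \<noteq> {}"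
  obtains L R :: "'b \<Rightarrow> complex set" where "facial_digraph (D :: ('a, 'b) pre_digraph) L R"
proof -
  interpret D: digraph D by (rule D)
  interpret drawn_digraph D pos \<gamma> by (rule drawn_digraph.intro[OF D.fin_digraph pl])
  obtain l r Q d where "sided_drawing D pos \<gamma> l r Q d" using sided_drawing_exists[OF sc] .
  then interpret sided_drawing D pos \<gamma> l r Q d .
  have "facial_digraph D left_face right_face"
    by unfold_locales
      (fact left_face_neq_right_face[OF sc] face_boundary_circulation face_cut_of_cycle faces_adjacent euler_inequality[OF ne])+
  then show thesis by (rule that)
qed

lemma digirth_le_length: "pre_digraph.cycle D p \<Longrightarrow> digirth D = enat g \<Longrightarrow> g \<le> length p"
  unfolding digirth_def by (metis INF_lower enat_ord_simps(1) mem_Collect_eq)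

theorem theorem7:
  fixes D :: "('a, 'b) pre_digraph" and g n m :: nat
  assumes "oriented_graph D"
    and "planar_digraph D"
    and "digirth D = enat g" and "g \<ge> 4"
    and "n = card (verts D)" and "m = card (arcs D)"
    and "strongly_connected D"
  shows "real (fv D) \<le> (real n - 2) / (real g - 3) - real m / (real g * (real g - 3))"
proof -
  have D: "digraph D" using assms(1) by (simp add: oriented_graph_def)
  obtain pos \<gamma> where pl: "plane_drawing D pos \<gamma>" using assms(2) by (auto simp: planar_digraph_def)
  have "arcs D \<noteq> {}"
  proof
    assume "arcs D = {}"
    then have "{p. pre_digraph.cycle D p} = {}" by (auto simp: pre_digraph.cycle_def pre_digraph.awalk_def)
    then have "digirth D = \<infinity>" by (simp add: digirth_def top_enat_def)
    then show False using assms(3) by simp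
  qed
  then obtain L R :: "'b \<Rightarrow> complex set" where "facial_digraph D L R"
    using planar_facial_digraph[OF D pl assms(7)] by blast
  then interpret facial_digraph D L R .
  have "int (fv D) * int g * (int g - 3) \<le> int g * (int n - 2) - int m"
    unfolding assms(5,6) using digirth_le_length[OF _ assms(3)] assms(4) by (rule feedback_bound)
  then have "real_of_int (int (fv D) * int g * (int g - 3)) \<le> real_of_int (int g * (int n - 2) - int m)"
    by (simp only: of_int_le_iff)
  then have "real (fv D) * (real g * (real g - 3)) \<le> real g * (real n - 2) - real m"
    by (simp add: mult.assoc)
  then have "real (fv D) \<le> (real g * (real n - 2) - real m) / (real g * (real g - 3))"
    using assms(4) by (simp add: pos_le_divide_eq)
  also have "\<dots> = (real n - 2) / (real g - 3) - real m / (real g * (real g - 3))"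
    using assms(4) by (simp add: diff_divide_distrib)
  finally show ?thesis .
qed

end
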